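(* Let $T\ge 1$, let $\lambda\ge 0$, and let $\mu=\mathcal N(a,A)$ and $\nu=\mathcal N(b,B)$ be non-degenerate Gaussian measures on $\mathbb R^{T}$ whose covariance matrices have Cholesky decompositions $A=LL^\top$ and $B=MM^\top$. Then $$\mathcal{AW}^2_{2,\lambda}(\mu,\nu)=|a-b|^2+\operatorname{tr}(A+B)-2\operatorname{tr}(P_\lambda N)-\frac{\lambda}{2}\log\det(I-P_\lambda^2),$$ where $N=\operatorname{diag}\big((M^\top L)_{11},\dots,(M^\top L)_{TT}\big)$ and $P_\lambda=f_\lambda(N)$, with $f_\lambda$ applied element-wise.
   Context: Elements of $\mathbb R^{T}$ are paths $x=(x_1,\dots,x_T)$ of real-valued processes with $T$ time steps; $|\cdot|$ is the Euclidean norm. Write $x_{1:t}=(x_1,\dots,x_t)$. For a probability measure $\mu$ on $\mathbb R^{T}$, $\mu_{x_{1:t}}$ denotes the regular conditional law under $\mu$ of $x_{t+1:T}$ given $x_{1:t}$; for a probability $\pi$ on $\mathbb R^{T}\times\mathbb R^{T}$, $\pi_{x_{1:t},y_{1:t}}$ denotes the regular conditional law of $(x_{t+1:T},y_{t+1:T})$ given $(x_{1:t},y_{1:t})$ (kernels being understood up to a.e. equality). $\mathrm{Cpl}(\mu,\nu)$ is the set of probability measures with first marginal $\mu$ and second marginal $\nu$. A coupling $\pi\in\mathrm{Cpl}(\mu,\nu)$ is bi-causal, written $\pi\in\mathrm{Cpl}_{\mathrm{bc}}(\mu,\nu)$, if for all $t=1,\dots,T-1$ and all $x_{1:t},y_{1:t}$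 one has $\pi_{x_{1:t},y_{1:t}}\in\mathrm{Cpl}(\mu_{x_{1:t}},\nu_{y_{1:t}})$. The entropic adapted 2-Wasserstein distance is $$\mathcal{AW}_{2,\lambda}^2(\mu,\nu)=\inf_{\pi\in\mathrm{Cpl}_{\mathrm{bc}}(\mu,\nu)}\int|x-y|^2\,d\pi+\lambda\,\mathcal D_{\mathrm{KL}}(\pi\,|\,\mu\otimes\nu),$$ where $\mathcal D_{\mathrm{KL}}(\mu|\nu)=\int\log(d\mu/d\nu)\,d\mu$ if $\mu\ll\nu$ and $+\infty$ otherwise. For $\lambda=0$ the entropic term is absent (so $\mathcal{AW}_{2,0}=\mathcal{AW}_2$ is the unregularized adapted Wasserstein distance), and likewise the term $\frac{\lambda}{2}\log\det(\cdot)$ is read as $0$ when $\lambda=0$. In the Cholesky decompositions, $L$ and $M$ are lower triangular with positive diagonal entries. For $\lambda\ge0$, $f_\lambda:\mathbb R\to\mathbb R$ is $$f_\lambda(x)=\operatorname{sign}(x)\Big(\sqrt{\big(\tfrac{\lambda}{4|x|}\big)^2+1}-\tfrac{\lambda}{4|x|}\Big)\ \text{ if }x\ne0,\qquad f_\lambda(0)=0.$$ In particular $f_0=\operatorname{sign}$, with $\operatorname{sign}(0)=0$. *)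

theory Defs
  imports "HOL-Probability.Probability" "Jordan_Normal_Form.Gauss_Jordan_Elimination"
    "Jordan_Normal_Form.Determinant"
begin

text \<open>Time is indexed from \<open>0\<close>: a path with \<open>T\<close> steps is a point of \<open>path_space {..<T}\<close>, its first
  \<open>t\<close> values form a point of \<open>path_space {..<t}\<close> and the remaining ones a point of
  \<open>path_space {t..<T}\<close>. Matrices and vectors of size \<open>T\<close> are likewise indexed by \<open>{..<T}\<close>.\<close>

abbreviation path_space :: "nat set \<Rightarrow> (nat \<Rightarrow> real) measure" where
  "path_space I \<equiv> PiM I (\<lambda>_. borel)"

definition sq_dist :: "nat \<Rightarrow> (nat \<Rightarrow> real) \<Rightarrow> (nat \<Rightarrow> real) \<Rightarrow> real" where
  "sq_dist T x y = (\<Sum>t<T. (x t - y t)\<^sup>2)"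

definition past :: "nat \<Rightarrow> (nat \<Rightarrow> real) \<Rightarrow> nat \<Rightarrow> real" where
  "past t x = restrict x {..<t}"

definition future :: "nat \<Rightarrow> nat \<Rightarrow> (nat \<Rightarrow> real) \<Rightarrow> nat \<Rightarrow> real" where
  "future T t x = restrict x {t..<T}"

definition couplings :: "'a measure \<Rightarrow> 'b measure \<Rightarrow> ('a \<times> 'b) measure set" where
  "couplings \<mu> \<nu> = {\<pi>. prob_space \<pi> \<and> sets \<pi> = sets (\<mu> \<Otimes>\<^sub>M \<nu>) \<and>
     distr \<pi> \<mu> fst = \<mu> \<and> distr \<pi> \<nu> snd = \<nu>}"

text \<open>\<open>K\<close> is a version of the regular conditional law of \<open>g\<close> (with values in \<open>E'\<close>)
  given \<open>f\<close> (with values in \<open>E\<close>) under \<open>\<mu>\<close>.\<close>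

definition regular_cond_law ::
  "'w measure \<Rightarrow> 'a measure \<Rightarrow> ('w \<Rightarrow> 'a) \<Rightarrow> 'b measure \<Rightarrow> ('w \<Rightarrow> 'b) \<Rightarrow> ('a \<Rightarrow> 'b measure) \<Rightarrow> bool" where
  "regular_cond_law \<mu> E f E' g K \<longleftrightarrow>
     K \<in> measurable E (prob_algebra E') \<and>
     (\<forall>C\<in>sets E. \<forall>D\<in>sets E'.
        emeasure \<mu> {w \<in> space \<mu>. f w \<in> C \<and> g w \<in> D} =
        (\<integral>\<^sup>+ w. indicator C (f w) * emeasure (K (f w)) D \<partial>\<mu>))"

definition path_cond_law ::
  "nat \<Rightarrow> nat \<Rightarrow> (nat \<Rightarrow> real) measure \<Rightarrow> ((nat \<Rightarrow> real) \<Rightarrow> (nat \<Rightarrow> real) measure) \<Rightarrow> bool" where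
  "path_cond_law T t \<mu> K \<longleftrightarrow>
     regular_cond_law \<mu> (path_space {..<t}) (past t) (path_space {t..<T}) (future T t) K"

definition pair_cond_law ::
  "nat \<Rightarrow> nat \<Rightarrow> ((nat \<Rightarrow> real) \<times> (nat \<Rightarrow> real)) measure \<Rightarrow>
    ((nat \<Rightarrow> real) \<times> (nat \<Rightarrow> real) \<Rightarrow> ((nat \<Rightarrow> real) \<times> (nat \<Rightarrow> real)) measure) \<Rightarrow> bool" where
  "pair_cond_law T t \<pi> K \<longleftrightarrow>
     regular_cond_law \<pi>
       (path_space {..<t} \<Otimes>\<^sub>M path_space {..<t}) (map_prod (past t) (past t))
       (path_space {t..<T} \<Otimes>\<^sub>M path_space {t..<T}) (map_prod (future T t) (future T t)) K"

text \<open>Regular conditional laws on these spaces exist and are unique up to null sets, so the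
  condition below does not depend on the versions \<open>K\<^sub>1\<close>, \<open>K\<^sub>2\<close>, \<open>K\<close> that are chosen.\<close>

definition bicausal_couplings ::
  "nat \<Rightarrow> (nat \<Rightarrow> real) measure \<Rightarrow> (nat \<Rightarrow> real) measure \<Rightarrow>
    ((nat \<Rightarrow> real) \<times> (nat \<Rightarrow> real)) measure set" where
  "bicausal_couplings T \<mu> \<nu> = {\<pi> \<in> couplings \<mu> \<nu>.
     \<forall>t\<in>{1..<T}. \<exists>K\<^sub>1 K\<^sub>2 K.
       path_cond_law T t \<mu> K\<^sub>1 \<and> path_cond_law T t \<nu> K\<^sub>2 \<and> pair_cond_law T t \<pi> K \<and>
       (AE (x, y) in \<pi>. K (past t x, past t y) \<in> couplings (K\<^sub>1 (past t x)) (K\<^sub>2 (past t y)))}"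

text \<open>The library's \<open>KL_divergence b R P\<close>, with the reference measure \<open>R\<close> first, is a real-valued
  Bochner integral. The negative part of \<open>log (dP/dR)\<close> is always \<open>P\<close>-integrable for probability
  measures, so if the logarithm is not \<open>P\<close>-integrable then its integral is \<open>\<infinity>\<close>.\<close>

definition KL :: "'a measure \<Rightarrow> 'a measure \<Rightarrow> ereal" where
  "KL P R = (if absolutely_continuous R P \<and> integrable P (entropy_density (exp 1) R P)
     then ereal (KL_divergence (exp 1) R P) else \<infinity>)"

text \<open>The square of the entropic adapted 2-Wasserstein distance. In \<^typ>\<open>ereal\<close>, \<open>0 * \<infinity> = 0\<close>, so
  the entropic term is absent for \<open>lam = 0\<close>.\<close>

definition AW2_sq :: "real \<Rightarrow> nat \<Rightarrow> (nat \<Rightarrow> real) measure \<Rightarrow> (nat \<Rightarrow> real) measure \<Rightarrow> ereal" where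
  "AW2_sq lam T \<mu> \<nu> = (INF \<pi>\<in>bicausal_couplings T \<mu> \<nu>.
     enn2ereal (\<integral>\<^sup>+ (x, y). ennreal (sq_dist T x y) \<partial>\<pi>) + ereal lam * KL \<pi> (\<mu> \<Otimes>\<^sub>M \<nu>))"

text \<open>The Gaussian law with mean \<open>a\<close> and positive definite covariance matrix \<open>A\<close>.\<close>

definition gaussian :: "nat \<Rightarrow> real Matrix.vec \<Rightarrow> real mat \<Rightarrow> (nat \<Rightarrow> real) measure" where
  "gaussian T a A = density (PiM {..<T} (\<lambda>_. lborel)) (\<lambda>x.
     let d = Matrix.vec T x - a in
     ennreal (exp (- (scalar_prod d (the (mat_inverse A) *\<^sub>v d)) / 2) /
              sqrt ((2 * pi) ^ T * Determinant.det A)))"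

definition tr :: "real mat \<Rightarrow> real" where
  "tr A = (\<Sum>i<dim_row A. A $$ (i, i))"

text \<open>Such an \<open>L\<close> exists iff \<open>A\<close> is symmetric positive definite, and is then unique.\<close>

definition cholesky :: "nat \<Rightarrow> real mat \<Rightarrow> real mat \<Rightarrow> bool" where
  "cholesky T A L \<longleftrightarrow> L \<in> carrier_mat T T \<and>
     (\<forall>i<T. \<forall>j<T. i < j \<longrightarrow> L $$ (i, j) = 0) \<and> (\<forall>i<T. 0 < L $$ (i, i)) \<and>
     A = L * transpose_mat L"

definition f_reg :: "real \<Rightarrow> real \<Rightarrow> real" where
  "f_reg lam x = (if x = 0 then 0
     else sgn x * (sqrt ((lam / (4 * \<bar>x\<bar>))\<^sup>2 + 1) - lam / (4 * \<bar>x\<bar>)))"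

end

theory Submission
  imports Defs
begin

text \<open>Write the two processes as \<open>X = a + L U\<close> and \<open>Y = b + M V\<close> with white noises \<open>U\<close>, \<open>V\<close>. Because \<open>L\<close> and
  \<open>M\<close> are lower triangular with positive diagonal, the past of \<open>X\<close> and the past of \<open>U\<close> determine each
  other, and likewise for \<open>Y\<close> and \<open>V\<close>. Under a bicausal coupling, given the joint past before \<open>t\<close>,
  \<open>V\<^sub>t\<close> has the same law as given the past of \<open>Y\<close> alone, so it is centred; hence
  \<open>E[U\<^sub>s V\<^sub>t] = 0\<close> for \<open>s < t\<close>, and symmetrically for \<open>s > t\<close>
  (\<open>bicausal_cross_uncorrelated\<close>). Only the correlations \<open>c\<^sub>t = E[U\<^sub>t V\<^sub>t]\<close> survive in
  \<open>E |X - Y|\<^sup>2\<close>, which equals \<open>|a - b|\<^sup>2 + tr (A + B) - 2 \<Sum>\<^sub>t N\<^sub>t c\<^sub>t\<close> (\<open>transport_cost_eq\<close>).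

  For \<open>\<lambda> = 0\<close> the bound \<open>|c\<^sub>t| \<le> 1\<close> gives the lower bound. For \<open>\<lambda> > 0\<close> let \<open>p\<^sub>t = f\<^sub>\<lambda>(N\<^sub>t)\<close> and let \<open>q\<close> be the
  density, with respect to the product law, of the coupling whose noise pairs \<open>(U\<^sub>t, V\<^sub>t)\<close> are
  independent in \<open>t\<close> and bivariate normal with correlation \<open>p\<^sub>t\<close>. Gibbs' inequality
  \<open>KL(\<pi>|R) \<ge> \<integral> ln q d\<pi>\<close> (\<open>KL_ge_integral_ln\<close>) bounds the entropy below by a quantity that is affine in the
  \<open>c\<^sub>t\<close>, and the number \<open>p\<^sub>t\<close> solves \<open>\<lambda> p / (1 - p\<^sup>2) = 2 N\<^sub>t\<close> (\<open>f_reg_optimal\<close>), which is exactly the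
  condition that \<open>c\<^sub>t\<close> cancels from the sum of the two terms. What remains is the claimed value, whatever the
  coupling.

  The coupling with correlations \<open>p\<^sub>t\<close> attains the bound. It is bicausal because the conditional laws
  of the future can be written down: keep the noise of the past and resample the noise from time \<open>t\<close> on
  (\<open>regular_cond_law_splice\<close>). It is defined by its noise rather than by a density, so that it also
  covers \<open>\<lambda> = 0\<close>, where \<open>|p\<^sub>t| = 1\<close> is possible.\<close>

section \<open>Lower triangular affine maps\<close>

lemma sets_path_lborel [measurable_cong]:
  "sets (PiM I (\<lambda>_. lborel)) = sets (path_space I)"
  by (intro sets_PiM_cong) auto

text \<open>The map \<open>u \<mapsto> a + L u\<close>. It reads only the entries of \<open>L\<close> on and below the diagonal, so time \<open>i\<close> of the
  image depends on the noise up to time \<open>i\<close> by construction.\<close>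

definition tri_map :: "nat \<Rightarrow> (nat \<Rightarrow> real) \<Rightarrow> (nat \<Rightarrow> nat \<Rightarrow> real) \<Rightarrow> (nat \<Rightarrow> real) \<Rightarrow> nat \<Rightarrow> real" where
  "tri_map n a L u = (\<lambda>i\<in>{..<n}. a i + (\<Sum>j\<le>i. L i j * u j))"

text \<open>Forward substitution. The guard \<open>j < i\<close> repeats the range of the sum to make the termination of the
  recursion visible; \<open>tri_inv_eq\<close> removes it.\<close>

fun tri_inv :: "(nat \<Rightarrow> real) \<Rightarrow> (nat \<Rightarrow> nat \<Rightarrow> real) \<Rightarrow> (nat \<Rightarrow> real) \<Rightarrow> nat \<Rightarrow> real" where
  "tri_inv a L x i = (x i - a i - (\<Sum>j\<in>{..<i}. if j < i then L i j * tri_inv a L x j else 0)) / L i i"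

declare tri_inv.simps [simp del]

lemma tri_inv_eq: "tri_inv a L x i = (x i - a i - (\<Sum>j<i. L i j * tri_inv a L x j)) / L i i"
  by (subst tri_inv.simps) simp

text \<open>The noise at time \<open>i\<close> is a function of the path up to time \<open>i\<close>; with \<open>past_tri_map_cong\<close> this is
  the sense in which path and noise carry the same information at every time.\<close>

lemma tri_inv_cong:
  assumes "\<And>j. j \<le> i \<Longrightarrow> x j = y j"
  shows "tri_inv a L x i = tri_inv a L y i"
  using assms
proof (induction i rule: less_induct)
  case (less i)
  then have "(\<Sum>j<i. L i j * tri_inv a L x j) = (\<Sum>j<i. L i j * tri_inv a L y j)"
    by (intro sum.cong) auto
  then show ?case
    using less.prems[of i] by (subst (1 2) tri_inv_eq) simp
qed

lemma tri_inv_tri_map: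
  assumes "\<And>j. j \<le> i \<Longrightarrow> L j j \<noteq> 0" "i < n"
  shows "tri_inv a L (tri_map n a L u) i = u i"
  using assms
proof (induction i rule: less_induct)
  case (less i)
  then have "(\<Sum>j<i. L i j * tri_inv a L (tri_map n a L u) j) = (\<Sum>j<i. L i j * u j)"
    by (intro sum.cong) auto
  moreover have "tri_map n a L u i = a i + (\<Sum>j<i. L i j * u j) + L i i * u i"
    using less.prems by (simp add: tri_map_def lessThan_Suc_atMost[symmetric] algebra_simps)
  ultimately show ?case
    using less.prems(1)[of i] by (subst tri_inv_eq) simp
qed

lemma tri_map_tri_inv:
  assumes "L i i \<noteq> 0" "i < n"
  shows "tri_map n a L (tri_inv a L x) i = x i"
proof -
  have "tri_map n a L (tri_inv a L x) i = a i + (\<Sum>j<i. L i j * tri_inv a L x j) + L i i * tri_inv a L x i"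
    using assms by (simp add: tri_map_def lessThan_Suc_atMost[symmetric])
  also have "\<dots> = x i"
    using assms by (subst (2) tri_inv_eq) simp
  finally show ?thesis .
qed

lemma tri_map_cong:
  assumes "\<And>j. j < n \<Longrightarrow> u j = v j"
  shows "tri_map n a L u = tri_map n a L v"
  unfolding tri_map_def using assms by (auto intro!: restrict_ext sum.cong)

lemma measurable_tri_map [measurable]:
  "tri_map n a L \<in> path_space {..<n} \<rightarrow>\<^sub>M path_space {..<n}"
  unfolding tri_map_def
  by (intro measurable_restrict borel_measurable_add borel_measurable_sum borel_measurable_times
      borel_measurable_const measurable_component_singleton) auto

lemma measurable_tri_inv:
  assumes "{..i} \<subseteq> I"
  shows "(\<lambda>x. tri_inv a L x i) \<in> borel_measurable (path_space I)"
  using assms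
proof (induction i rule: less_induct)
  case (less i)
  have "(\<lambda>x. \<Sum>j<i. L i j * tri_inv a L x j) \<in> borel_measurable (path_space I)"
    using less by (intro borel_measurable_sum borel_measurable_times borel_measurable_const less.IH) auto
  moreover have "(\<lambda>x. x i) \<in> borel_measurable (path_space I)"
    using less.prems by (intro measurable_component_singleton) auto
  ultimately show ?case
    by (subst tri_inv_eq) (intro borel_measurable_divide borel_measurable_diff borel_measurable_const)
qed

text \<open>The change of variables formula, by induction on the dimension: once the first \<open>n\<close> coordinates are
  substituted, the last one is a one-dimensional affine substitution with slope \<open>L n n\<close>.\<close>

lemma nn_integral_tri_map:
  assumes "\<And>i. i < n \<Longrightarrow> 0 < L i i"
    and "f \<in> borel_measurable (path_space {..<n})"
  shows "(\<integral>\<^sup>+x. f x \<partial>PiM {..<n} (\<lambda>_. lborel)) =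
    ennreal (\<Prod>i<n. L i i) * (\<integral>\<^sup>+u. f (tri_map n a L u) \<partial>PiM {..<n} (\<lambda>_. lborel))"
  using assms
proof (induction n arbitrary: f)
  case 0
  then show ?case by (simp add: tri_map_def PiM_empty nn_integral_count_space_finite restrict_def)
next
  case (Suc n)
  interpret product_sigma_finite "\<lambda>_::nat. lborel :: real measure" ..
  let ?M = "PiM {..<n} (\<lambda>_. lborel :: real measure)"
  note [measurable] = Suc.prems(2)
  have upd [measurable]: "(\<lambda>x. (fst x)(n := snd x)) \<in> path_space {..<n} \<Otimes>\<^sub>M borel \<rightarrow>\<^sub>M path_space {..<Suc n}"
    by (rule measurable_fun_upd[where J = "{..<n}"]) auto
  have [measurable]: "(\<lambda>(x, y). f (x(n := y))) \<in> borel_measurable (path_space {..<n} \<Otimes>\<^sub>M borel)"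
    unfolding case_prod_beta by measurable
  have split: "(\<integral>\<^sup>+x. g x \<partial>PiM {..<Suc n} (\<lambda>_. lborel)) = (\<integral>\<^sup>+x. \<integral>\<^sup>+y. g (x(n := y)) \<partial>lborel \<partial>?M)"
    if "g \<in> borel_measurable (path_space {..<Suc n})" for g
    using that unfolding lessThan_Suc
    by (intro product_nn_integral_insert) (auto simp: measurable_cong_sets[OF sets_path_lborel])
  have step: "tri_map (Suc n) a L (u(n := w)) = (tri_map n a L u)(n := (a n + (\<Sum>j<n. L n j * u j)) + L n n * w)"
    for u w
    by (auto simp: tri_map_def lessThan_Suc_atMost[symmetric] fun_eq_iff less_Suc_eq algebra_simps
        intro!: sum.cong)
  have "(\<integral>\<^sup>+x. f x \<partial>PiM {..<Suc n} (\<lambda>_. lborel)) = (\<integral>\<^sup>+x. \<integral>\<^sup>+y. f (x(n := y)) \<partial>lborel \<partial>?M)"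
    by (intro split) measurable
  also have "\<dots> = ennreal (\<Prod>i<n. L i i) * (\<integral>\<^sup>+u. \<integral>\<^sup>+y. f ((tri_map n a L u)(n := y)) \<partial>lborel \<partial>?M)"
  proof (rule Suc.IH)
    show "(\<lambda>x. \<integral>\<^sup>+y. f (x(n := y)) \<partial>lborel) \<in> borel_measurable (path_space {..<n})"
      by measurable
  qed (use Suc.prems(1) in auto)
  also have "(\<integral>\<^sup>+u. \<integral>\<^sup>+y. f ((tri_map n a L u)(n := y)) \<partial>lborel \<partial>?M) =
     (\<integral>\<^sup>+u. ennreal (L n n) * (\<integral>\<^sup>+w. f (tri_map (Suc n) a L (u(n := w))) \<partial>lborel) \<partial>?M)"
  proof (intro nn_integral_cong)
    fix u assume "u \<in> space ?M"
    then have u: "tri_map n a L u \<in> space (path_space {..<n})"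
      by (auto simp: tri_map_def space_PiM)
    have [measurable]: "(\<lambda>y. f ((tri_map n a L u)(n := y))) \<in> borel_measurable borel"
      using measurable_compose[OF measurable_Pair1'[OF u], of "\<lambda>(x, y). f (x(n := y))" borel borel]
      by simp
    show "(\<integral>\<^sup>+y. f ((tri_map n a L u)(n := y)) \<partial>lborel) =
       ennreal (L n n) * (\<integral>\<^sup>+w. f (tri_map (Suc n) a L (u(n := w))) \<partial>lborel)"
      unfolding step using Suc.prems(1)[of n]
      by (subst nn_integral_real_affine[where c="L n n" and t="a n + (\<Sum>j<n. L n j * u j)"]) auto
  qed
  also have "\<dots> = ennreal (L n n) * (\<integral>\<^sup>+u. f (tri_map (Suc n) a L u) \<partial>PiM {..<Suc n} (\<lambda>_. lborel))"
  proof (subst split)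
    show "(\<lambda>x. f (tri_map (Suc n) a L x)) \<in> borel_measurable (path_space {..<Suc n})"
      by measurable
    have [measurable]: "(\<lambda>(x, y). f (tri_map (Suc n) a L (x(n := y)))) \<in> borel_measurable (path_space {..<n} \<Otimes>\<^sub>M borel)"
      unfolding case_prod_beta by measurable
    show "(\<integral>\<^sup>+u. ennreal (L n n) * (\<integral>\<^sup>+w. f (tri_map (Suc n) a L (u(n := w))) \<partial>lborel) \<partial>?M) =
      ennreal (L n n) * (\<integral>\<^sup>+u. \<integral>\<^sup>+w. f (tri_map (Suc n) a L (u(n := w))) \<partial>lborel \<partial>?M)"
      by (intro nn_integral_cmult) measurable
  qed
  also have "ennreal (\<Prod>i<n. L i i) * \<dots> = ennreal (\<Prod>i<Suc n. L i i) *
      (\<integral>\<^sup>+u. f (tri_map (Suc n) a L u) \<partial>PiM {..<Suc n} (\<lambda>_. lborel))"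
  proof -
    have "0 \<le> (\<Prod>i<n. L i i)" "0 \<le> L n n"
      using Suc.prems(1) by (auto intro!: prod_nonneg simp: less_imp_le)
    then have "ennreal (\<Prod>i<Suc n. L i i) = ennreal (\<Prod>i<n. L i i) * ennreal (L n n)"
      by (simp add: ennreal_mult)
    then show ?thesis by (simp add: mult.assoc)
  qed
  finally show ?case .
qed

section \<open>White noise and Gaussian laws\<close>

lemma PiM_density:
  assumes "finite I" "product_sigma_finite M" "product_sigma_finite (\<lambda>i. density (M i) (f i))"
    and [measurable]: "\<And>i. i \<in> I \<Longrightarrow> f i \<in> borel_measurable (M i)"
  shows "PiM I (\<lambda>i. density (M i) (f i)) = density (PiM I M) (\<lambda>x. \<Prod>i\<in>I. f i (x i))"
proof -
  interpret M: product_sigma_finite M by fact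
  interpret D: product_sigma_finite "\<lambda>i. density (M i) (f i)" by fact
  show ?thesis
  proof (rule D.PiM_eqI[symmetric, OF \<open>finite I\<close>])
    show "sets (density (PiM I M) (\<lambda>x. \<Prod>i\<in>I. f i (x i))) = sets (PiM I (\<lambda>i. density (M i) (f i)))"
      by (auto intro!: sets_PiM_cong)
    fix A assume A: "\<And>i. i \<in> I \<Longrightarrow> A i \<in> sets (density (M i) (f i))"
    then have [measurable]: "i \<in> I \<Longrightarrow> A i \<in> sets (M i)" for i by auto
    have "Pi\<^sub>E I A \<in> sets (PiM I M)" using \<open>finite I\<close> by (intro sets_PiM_I_finite) auto
    then have "emeasure (density (PiM I M) (\<lambda>x. \<Prod>i\<in>I. f i (x i))) (Pi\<^sub>E I A)
       = (\<integral>\<^sup>+x. (\<Prod>i\<in>I. f i (x i)) * indicator (Pi\<^sub>E I A) x \<partial>PiM I M)"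
      by (intro emeasure_density) (auto intro!: borel_measurable_prod_ennreal)
    also have "\<dots> = (\<integral>\<^sup>+x. (\<Prod>i\<in>I. f i (x i) * indicator (A i) (x i)) \<partial>PiM I M)"
      using \<open>finite I\<close>
      by (intro nn_integral_cong) (auto simp: prod.distrib space_PiM PiE_iff indicator_def prod_zero_iff)
    also have "\<dots> = (\<Prod>i\<in>I. (\<integral>\<^sup>+x. f i x * indicator (A i) x \<partial>M i))"
      using \<open>finite I\<close> by (intro M.product_nn_integral_prod) auto
    also have "\<dots> = (\<Prod>i\<in>I. emeasure (density (M i) (f i)) (A i))"
      by (intro prod.cong) (auto simp: emeasure_density)
    finally show "emeasure (density (PiM I M) (\<lambda>x. \<Prod>i\<in>I. f i (x i))) (Pi\<^sub>E I A) =
      (\<Prod>i\<in>I. emeasure (density (M i) (f i)) (A i))" .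
  qed
qed

lemma distr_PiM_componentwise:
  assumes "finite I" "product_sigma_finite M" "product_sigma_finite (\<lambda>i. distr (M i) (N i) (f i))"
    and [measurable]: "\<And>i. i \<in> I \<Longrightarrow> f i \<in> M i \<rightarrow>\<^sub>M N i"
  shows "distr (PiM I M) (PiM I N) (\<lambda>x. \<lambda>i\<in>I. f i (x i)) = PiM I (\<lambda>i. distr (M i) (N i) (f i))"
proof -
  interpret M: product_sigma_finite M by fact
  interpret D: product_sigma_finite "\<lambda>i. distr (M i) (N i) (f i)" by fact
  show ?thesis
  proof (rule D.PiM_eqI[OF \<open>finite I\<close>])
    show "sets (distr (PiM I M) (PiM I N) (\<lambda>x. \<lambda>i\<in>I. f i (x i))) = sets (PiM I (\<lambda>i. distr (M i) (N i) (f i)))"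
      by (auto intro!: sets_PiM_cong)
    fix A assume A: "\<And>i. i \<in> I \<Longrightarrow> A i \<in> sets (distr (M i) (N i) (f i))"
    then have [measurable]: "i \<in> I \<Longrightarrow> A i \<in> sets (N i)" for i by auto
    have "Pi\<^sub>E I A \<in> sets (PiM I N)" using \<open>finite I\<close> by (intro sets_PiM_I_finite) auto
    then have "emeasure (distr (PiM I M) (PiM I N) (\<lambda>x. \<lambda>i\<in>I. f i (x i))) (Pi\<^sub>E I A)
       = emeasure (PiM I M) ((\<lambda>x. \<lambda>i\<in>I. f i (x i)) -` Pi\<^sub>E I A \<inter> space (PiM I M))"
      by (intro emeasure_distr) (auto intro!: measurable_restrict)
    also have "(\<lambda>x. \<lambda>i\<in>I. f i (x i)) -` Pi\<^sub>E I A \<inter> space (PiM I M) = Pi\<^sub>E I (\<lambda>i. f i -` A i \<inter> space (M i))"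
      by (auto simp: space_PiM PiE_iff)
    also have "emeasure (PiM I M) \<dots> = (\<Prod>i\<in>I. emeasure (M i) (f i -` A i \<inter> space (M i)))"
      using \<open>finite I\<close> by (intro M.emeasure_PiM) auto
    also have "\<dots> = (\<Prod>i\<in>I. emeasure (distr (M i) (N i) (f i)) (A i))"
      by (intro prod.cong) (auto simp: emeasure_distr)
    finally show "emeasure (distr (PiM I M) (PiM I N) (\<lambda>x. \<lambda>i\<in>I. f i (x i))) (Pi\<^sub>E I A) =
      (\<Prod>i\<in>I. emeasure (distr (M i) (N i) (f i)) (A i))" .
  qed
qed

definition std_normal :: "real measure" where
  "std_normal = density lborel std_normal_density"

lemma sets_std_normal [simp, measurable_cong]: "sets std_normal = sets borel"
  by (simp add: std_normal_def)

lemma space_std_normal [simp]: "space std_normal = UNIV"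
  by (simp add: std_normal_def)

lemma prob_space_std_normal [simp]: "prob_space std_normal"
  unfolding std_normal_def by (rule prob_space_normal_density) simp

interpretation std_normal: prob_space std_normal by simp

lemma nn_integral_std_normal:
  "f \<in> borel_measurable borel \<Longrightarrow>
    (\<integral>\<^sup>+x. f x \<partial>std_normal) = (\<integral>\<^sup>+x. ennreal (std_normal_density x) * f x \<partial>lborel)"
  by (simp add: std_normal_def nn_integral_density)

definition white_noise :: "nat \<Rightarrow> (nat \<Rightarrow> real) measure" where
  "white_noise n = PiM {..<n} (\<lambda>_. std_normal)"

lemma sets_white_noise [simp, measurable_cong]: "sets (white_noise n) = sets (path_space {..<n})"
  unfolding white_noise_def by (intro sets_PiM_cong) auto

lemma space_white_noise: "space (white_noise n) = space (path_space {..<n})"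
  by (intro sets_eq_imp_space_eq) simp

lemma prob_space_white_noise [simp]: "prob_space (white_noise n)"
  unfolding white_noise_def by (intro prob_space_PiM) simp

lemma white_noise_density:
  "white_noise n = density (PiM {..<n} (\<lambda>_. lborel)) (\<lambda>x. \<Prod>i<n. ennreal (std_normal_density (x i)))"
  unfolding white_noise_def std_normal_def
proof (rule PiM_density)
  show "product_sigma_finite (\<lambda>_::nat. density lborel std_normal_density)"
    using prob_space_imp_sigma_finite[OF prob_space_std_normal]
    by (simp add: product_sigma_finite_def std_normal_def)
  show "product_sigma_finite (\<lambda>_::nat. lborel :: real measure)" ..
qed auto

lemma cholesky_det:
  fixes L :: "real mat"
  assumes "cholesky T A L"
  shows "Determinant.det L = (\<Prod>i<T. L $$ (i, i))" "0 < (\<Prod>i<T. L $$ (i, i))"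
    "Determinant.det A = (\<Prod>i<T. L $$ (i, i))\<^sup>2"
proof -
  have L: "L \<in> carrier_mat T T" "\<And>i j. i < j \<Longrightarrow> j < T \<Longrightarrow> L $$ (i, j) = 0" "A = L * transpose_mat L"
    "\<And>i. i < T \<Longrightarrow> 0 < L $$ (i, i)"
    using assms by (auto simp: cholesky_def)
  show d: "Determinant.det L = (\<Prod>i<T. L $$ (i, i))"
    using det_lower_triangular[OF L(2,1)] L(1) by (simp add: prod_list_diag_prod lessThan_atLeast0)
  show "Determinant.det A = (\<Prod>i<T. L $$ (i, i))\<^sup>2"
    using L(1) d unfolding L(3)
    by (simp add: det_mult[of _ T] Determinant.det_transpose[of _ T] power2_eq_square)
  show "0 < (\<Prod>i<T. L $$ (i, i))"
    using L(4) by (intro prod_pos) auto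
qed

lemma cholesky_mat_inverse:
  fixes L :: "real mat"
  assumes "cholesky T A L"
  obtains B where "mat_inverse A = Some B" "A * B = 1\<^sub>m T" "B \<in> carrier_mat T T"
proof -
  have L: "L \<in> carrier_mat T T" and A: "A = L * transpose_mat L"
    using assms by (auto simp: cholesky_def)
  have A': "A \<in> carrier_mat T T" unfolding A by (rule mult_carrier_mat[OF L]) (use L in simp)
  have "Determinant.det A \<noteq> 0"
    using cholesky_det[OF assms] by (metis less_irrefl zero_eq_power2)
  then have "A \<in> Units (ring_mat TYPE(real) T ())" by (rule det_non_zero_imp_unit[OF A'])
  then have "mat_inverse A \<noteq> None" using mat_inverse(1)[OF A', where b = "()"] by blast
  then show ?thesis using mat_inverse(2)[OF A'] that by auto
qed

text \<open>With \<open>y = A\<inverse> L v\<close>, cancelling \<open>L\<close> in \<open>L L\<^sup>T y = L v\<close> gives \<open>L\<^sup>T y = v\<close>, and the quadratic form is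
  \<open>(L v) \<bullet> y = v \<bullet> (L\<^sup>T y)\<close>.\<close>

lemma cholesky_quadratic_form:
  fixes L :: "real mat"
  assumes "cholesky T A L" and v [simp]: "v \<in> carrier_vec T"
  shows "scalar_prod (L *\<^sub>v v) (the (mat_inverse A) *\<^sub>v (L *\<^sub>v v)) = scalar_prod v v"
proof -
  have L [simp]: "L \<in> carrier_mat T T" and A: "A = L * transpose_mat L"
    using assms by (auto simp: cholesky_def)
  have Lt [simp]: "transpose_mat L \<in> carrier_mat T T" by simp
  have A' [simp]: "A \<in> carrier_mat T T" unfolding A by (rule mult_carrier_mat[OF L Lt])
  have [simp]: "M *\<^sub>v w \<in> carrier_vec T" if "M \<in> carrier_mat T T" "w \<in> carrier_vec T"
    for M :: "real mat" and w using that by (rule mult_mat_vec_carrier)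
  have assoc: "(M * N) *\<^sub>v w = M *\<^sub>v (N *\<^sub>v w)"
    if "M \<in> carrier_mat T T" "N \<in> carrier_mat T T" "w \<in> carrier_vec T"
    for M N :: "real mat" and w using that by (rule assoc_mult_mat_vec)
  have dL: "Determinant.det L \<noteq> 0"
    using cholesky_det[OF assms(1)] by (metis less_irrefl)
  obtain B where B: "mat_inverse A = Some B" and AB: "A * B = 1\<^sub>m T" and B' [simp]: "B \<in> carrier_mat T T"
    by (rule cholesky_mat_inverse[OF assms(1)])
  obtain C where C: "C * L = 1\<^sub>m T" and C' [simp]: "C \<in> carrier_mat T T"
    using det_non_zero_imp_unit[OF L dL, of undefined]
    by (auto simp: Units_def ring_mat_def)
  define y where "y = B *\<^sub>v (L *\<^sub>v v)"
  have y [simp]: "y \<in> carrier_vec T" by (simp add: y_def)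
  have "L *\<^sub>v (transpose_mat L *\<^sub>v y) = A *\<^sub>v y"
    unfolding A by (rule assoc[symmetric]) auto
  also have "\<dots> = (A * B) *\<^sub>v (L *\<^sub>v v)"
    unfolding y_def by (rule assoc[symmetric]) auto
  also have "\<dots> = L *\<^sub>v v" unfolding AB by (rule one_mult_mat_vec) simp
  finally have "C *\<^sub>v (L *\<^sub>v (transpose_mat L *\<^sub>v y)) = C *\<^sub>v (L *\<^sub>v v)" by simp
  then have "(C * L) *\<^sub>v (transpose_mat L *\<^sub>v y) = (C * L) *\<^sub>v v"
    by (simp add: assoc)
  then have Ly: "transpose_mat L *\<^sub>v y = v"
    unfolding C by (metis Lt y v one_mult_mat_vec mult_mat_vec_carrier)
  have "scalar_prod (L *\<^sub>v v) y = scalar_prod y (L *\<^sub>v v)"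
    by (rule comm_scalar_prod[of _ T]) auto
  also have "\<dots> = scalar_prod (transpose_mat L *\<^sub>v y) v"
    by (rule transpose_vec_mult_scalar[OF L v y, symmetric])
  finally show ?thesis by (simp add: Ly B y_def[symmetric])
qed

text \<open>The density of the Gaussian law, pulled back along \<open>u \<mapsto> a + L u\<close> and multiplied by the Jacobian
  \<open>det L\<close>, is the density of white noise. This reduces statements about the covariance matrix to statements
  about its Cholesky factor.\<close>

lemma gaussian_eq_distr:
  fixes L :: "real mat"
  assumes chol: "cholesky T A L" and a: "a \<in> carrier_vec T"
  shows "gaussian T a A = distr (white_noise T) (path_space {..<T})
    (tri_map T (\<lambda>i. vec_index a i) (\<lambda>i j. L $$ (i, j)))" (is "_ = distr _ _ ?\<Phi>")
proof -
  define q where "q x = (let d = Matrix.vec T x - a in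
     ennreal (exp (- (scalar_prod d (the (mat_inverse A) *\<^sub>v d)) / 2) /
              sqrt ((2 * pi) ^ T * Determinant.det A)))" for x
  have L: "L \<in> carrier_mat T T" "\<And>i j. i < j \<Longrightarrow> j < T \<Longrightarrow> L $$ (i, j) = 0"
    "\<And>i. i < T \<Longrightarrow> 0 < L $$ (i, i)" "A \<in> carrier_mat T T"
    using chol by (auto simp: cholesky_def)
  define D where "D = (\<Prod>i<T. L $$ (i, i))"
  note det = cholesky_det[OF chol, folded D_def]
  have [measurable]: "q \<in> borel_measurable (path_space {..<T})"
  proof -
    obtain B where "mat_inverse A = Some B" and B': "B \<in> carrier_mat T T"
      by (rule cholesky_mat_inverse[OF chol])
    then have B: "the (mat_inverse A) = B" by simp
    have "q x = ennreal (exp (- (\<Sum>i<T. (x i - vec_index a i) * (\<Sum>j<T. B $$ (i, j) * (x j - vec_index a j))) / 2) /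
              sqrt ((2 * pi) ^ T * Determinant.det A))" for x
      unfolding q_def Let_def B using a B'
      by (simp add: scalar_prod_def lessThan_atLeast0)
    then have "q = (\<lambda>x. ennreal (exp (- (\<Sum>i<T. (x i - vec_index a i) * (\<Sum>j<T. B $$ (i, j) * (x j - vec_index a j))) / 2) /
              sqrt ((2 * pi) ^ T * Determinant.det A)))" by auto
    then show ?thesis by (simp cong: measurable_cong_simp) 
  qed
  have qT: "ennreal D * q (?\<Phi> u) = (\<Prod>i<T. ennreal (std_normal_density (u i)))" for u
  proof -
    have "Matrix.vec T (?\<Phi> u) - a = L *\<^sub>v Matrix.vec T u"
    proof (intro eq_vecI)
      fix i assume "i < dim_vec (L *\<^sub>v Matrix.vec T u)"
      then have i: "i < T" using L by simp
      have "(\<Sum>j<T. L $$ (i, j) * u j) = (\<Sum>j\<le>i. L $$ (i, j) * u j)"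
        using i L(2) by (intro sum.mono_neutral_right) auto
      then show "vec_index (Matrix.vec T (?\<Phi> u) - a) i = vec_index (L *\<^sub>v Matrix.vec T u) i"
        using i L(1) a by (simp add: tri_map_def scalar_prod_def lessThan_atLeast0)
    qed (use L a in auto)
    then have "q (?\<Phi> u) = ennreal (exp (- (\<Sum>i<T. (u i)\<^sup>2) / 2) / (sqrt ((2 * pi) ^ T) * D))"
      unfolding q_def Let_def using cholesky_quadratic_form[OF chol, of "Matrix.vec T u"] det(2)
      by (simp add: det(3) real_sqrt_mult scalar_prod_def lessThan_atLeast0 power2_eq_square[of "u _"])
    then have "ennreal D * q (?\<Phi> u) = ennreal (D * (exp (- (\<Sum>i<T. (u i)\<^sup>2) / 2) / (sqrt ((2 * pi) ^ T) * D)))"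
      using det(2) by (simp only: ennreal_mult'[OF less_imp_le])
    also have "D * (exp (- (\<Sum>i<T. (u i)\<^sup>2) / 2) / (sqrt ((2 * pi) ^ T) * D)) =
       (\<Prod>i<T. std_normal_density (u i))"
      using det(2)
      by (simp add: std_normal_density_def prod.distrib exp_sum[symmetric] sum_divide_distrib sum_negf
          real_sqrt_mult real_sqrt_power power_mult_distrib power_divide prod_dividef)
    finally show ?thesis by (simp add: prod_ennreal)
  qed
  show ?thesis
  proof (rule measure_eqI)
    show "sets (gaussian T a A) = sets (distr (white_noise T) (path_space {..<T}) ?\<Phi>)"
      by (simp add: gaussian_def sets_path_lborel)
    fix X assume "X \<in> sets (gaussian T a A)"
    then have [measurable]: "X \<in> sets (path_space {..<T})" by (simp add: gaussian_def sets_path_lborel)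
    let ?M = "PiM {..<T} (\<lambda>_. lborel :: real measure)"
    have "emeasure (gaussian T a A) X = (\<integral>\<^sup>+x. q x * indicator X x \<partial>?M)"
      unfolding gaussian_def q_def[symmetric] by (intro emeasure_density) (simp_all add: measurable_cong_sets[OF sets_path_lborel] sets_path_lborel)
    also have "\<dots> = ennreal D * (\<integral>\<^sup>+u. q (?\<Phi> u) * indicator X (?\<Phi> u) \<partial>?M)"
      unfolding D_def by (rule nn_integral_tri_map) (use L in auto)
    also have "\<dots> = (\<integral>\<^sup>+u. ennreal D * (q (?\<Phi> u) * indicator X (?\<Phi> u)) \<partial>?M)"
      by (intro nn_integral_cmult[symmetric]) measurable
    also have "\<dots> = (\<integral>\<^sup>+u. (\<Prod>i<T. ennreal (std_normal_density (u i))) * indicator X (?\<Phi> u) \<partial>?M)"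
      unfolding qT[symmetric] by (simp add: mult.assoc)
    also have "\<dots> = (\<integral>\<^sup>+u. indicator X (?\<Phi> u) \<partial>white_noise T)"
      unfolding white_noise_density by (intro nn_integral_density[symmetric]) measurable
    also have "\<dots> = emeasure (distr (white_noise T) (path_space {..<T}) ?\<Phi>) X"
      by (subst nn_integral_indicator[symmetric]) (simp, subst nn_integral_distr, measurable)
    finally show "emeasure (gaussian T a A) X = emeasure (distr (white_noise T) (path_space {..<T}) ?\<Phi>) X" .
  qed
qed

section \<open>Conditional laws that depend on part of the information\<close>

text \<open>Disintegration: the defining property of a regular conditional law says that two probability measures
  agree on rectangles, hence they agree.\<close>

lemma nn_integral_regular_cond_law:
  assumes "prob_space \<mu>" and [measurable]: "f \<in> \<mu> \<rightarrow>\<^sub>M E" "g \<in> \<mu> \<rightarrow>\<^sub>M E'"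
    and K: "regular_cond_law \<mu> E f E' g K"
    and [measurable]: "k \<in> borel_measurable (E \<Otimes>\<^sub>M E')"
  shows "(\<integral>\<^sup>+w. k (f w, g w) \<partial>\<mu>) = (\<integral>\<^sup>+w. \<integral>\<^sup>+z. k (f w, z) \<partial>K (f w) \<partial>\<mu>)"
proof -
  interpret prob_space \<mu> by fact
  have Kp [measurable]: "K \<in> E \<rightarrow>\<^sub>M prob_algebra E'"
    using K by (simp add: regular_cond_law_def)
  then have Ks [measurable]: "K \<in> E \<rightarrow>\<^sub>M subprob_algebra E'" by (rule measurable_prob_algebraD)
  define J where "J = distr \<mu> (E \<Otimes>\<^sub>M E') (\<lambda>w. (f w, g w))"
  define B where "B = distr \<mu> E f \<bind> (\<lambda>x. distr (K x) (E \<Otimes>\<^sub>M E') (\<lambda>z. (x, z)))"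
  have ker [measurable]: "(\<lambda>x. distr (K x) (E \<Otimes>\<^sub>M E') (\<lambda>z. (x, z))) \<in> distr \<mu> E f \<rightarrow>\<^sub>M subprob_algebra (E \<Otimes>\<^sub>M E')"
    by (intro measurable_prob_algebraD measurable_distr_prob_space2[where M=E']) (use Kp in simp_all)
  have ne: "space (distr \<mu> E f) \<noteq> {}"
    using not_empty measurable_space[of f \<mu> E] by auto
  have setsB: "sets B = sets (E \<Otimes>\<^sub>M E')"
    unfolding B_def by (rule sets_bind[OF _ ne]) (simp add: subprob_measurableD(2)[OF ker])
  have nnB: "(\<integral>\<^sup>+p. h p \<partial>B) = (\<integral>\<^sup>+w. \<integral>\<^sup>+z. h (f w, z) \<partial>K (f w) \<partial>\<mu>)"
    if [measurable]: "h \<in> borel_measurable (E \<Otimes>\<^sub>M E')" for h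
  proof -
    have "(\<integral>\<^sup>+p. h p \<partial>B) = (\<integral>\<^sup>+x. \<integral>\<^sup>+p. h p \<partial>distr (K x) (E \<Otimes>\<^sub>M E') (\<lambda>z. (x, z)) \<partial>distr \<mu> E f)"
      unfolding B_def by (rule nn_integral_bind[OF _ ker]) measurable
    also have "\<dots> = (\<integral>\<^sup>+x. \<integral>\<^sup>+z. h (x, z) \<partial>K x \<partial>distr \<mu> E f)"
    proof (intro nn_integral_cong)
      fix x assume "x \<in> space (distr \<mu> E f)"
      then have [measurable_cong]: "sets (K x) = sets E'" and [simp]: "x \<in> space E"
        using subprob_measurableD(2)[OF Ks] by auto
      show "(\<integral>\<^sup>+p. h p \<partial>distr (K x) (E \<Otimes>\<^sub>M E') (\<lambda>z. (x, z))) = (\<integral>\<^sup>+z. h (x, z) \<partial>K x)"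
        by (subst nn_integral_distr) auto
    qed
    also have "\<dots> = (\<integral>\<^sup>+w. \<integral>\<^sup>+z. h (f w, z) \<partial>K (f w) \<partial>\<mu>)"
      by (intro nn_integral_distr nn_integral_measurable_subprob_algebra2[where N=E']) measurable
    finally show ?thesis .
  qed
  let ?G = "{C \<times> D |C D. C \<in> sets E \<and> D \<in> sets E'}"
  have "J = B"
  proof (rule measure_eqI_generator_eq[where \<Omega> = "space E \<times> space E'" and E = ?G and A = "\<lambda>_. space E \<times> space E'"])
    show "Int_stable ?G" by (rule Int_stable_pair_measure_generator)
    show "?G \<subseteq> Pow (space E \<times> space E')" by (auto dest: sets.sets_into_space)
    show "sets J = sigma_sets (space E \<times> space E') ?G" by (simp add: J_def sets_pair_measure)
    show "sets B = sigma_sets (space E \<times> space E') ?G" by (simp add: setsB sets_pair_measure)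
    show "range (\<lambda>_. space E \<times> space E') \<subseteq> ?G" by auto
    show "(\<Union>i::nat. space E \<times> space E') = space E \<times> space E'" by auto
    show "emeasure J (space E \<times> space E') \<noteq> \<infinity>" for i :: nat
    proof -
      have "prob_space J" unfolding J_def by (rule prob_space_distr) measurable
      then show ?thesis using prob_space.emeasure_le_1 by (metis ennreal_one_less_top infinity_ennreal_def leD)
    qed
    fix X assume "X \<in> ?G"
    then obtain C D where X: "X = C \<times> D" and [measurable]: "C \<in> sets E" "D \<in> sets E'" by auto
    have "emeasure J X = emeasure \<mu> {w \<in> space \<mu>. f w \<in> C \<and> g w \<in> D}"
      unfolding J_def X by (subst emeasure_distr) (auto intro!: arg_cong2[where f = emeasure])
    also have "\<dots> = (\<integral>\<^sup>+w. indicator C (f w) * emeasure (K (f w)) D \<partial>\<mu>)"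
      using K by (simp add: regular_cond_law_def)
    also have "\<dots> = (\<integral>\<^sup>+w. \<integral>\<^sup>+z. indicator (C \<times> D) (f w, z) \<partial>K (f w) \<partial>\<mu>)"
    proof (intro nn_integral_cong)
      fix w assume "w \<in> space \<mu>"
      then have "f w \<in> space E" using measurable_space[of f \<mu> E] by auto
      then have "sets (K (f w)) = sets E'"
        using subprob_measurableD(2)[OF Ks] by auto
      then have D: "D \<in> sets (K (f w))" by simp
      show "indicator C (f w) * emeasure (K (f w)) D = (\<integral>\<^sup>+z. indicator (C \<times> D) (f w, z) \<partial>K (f w))"
        unfolding indicator_times fst_conv snd_conv
        by (subst nn_integral_cmult) (simp_all add: D borel_measurable_indicator)
    qed
    also have "\<dots> = emeasure B X"
      unfolding X by (subst nnB[symmetric]) (auto simp: setsB)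
    finally show "emeasure J X = emeasure B X" .
  qed
  moreover have "(\<integral>\<^sup>+p. k p \<partial>J) = (\<integral>\<^sup>+w. k (f w, g w) \<partial>\<mu>)"
    unfolding J_def by (rule nn_integral_distr) measurable
  ultimately show ?thesis
    using nnB[of k] by simp
qed

text \<open>The core of causality. If the conditional law of \<open>g\<close> given the large information \<open>f\<close> depends only on
  the small information \<open>r (f w)\<close>, then the conditional means of \<open>v\<^sub>1\<close> and \<open>v\<^sub>2\<close> given \<open>f\<close> are functions of
  \<open>r (f w)\<close>. Being equal when tested against the small information, they are equal almost surely, and so
  they are equal when tested against the large information.\<close>

lemma cond_law_balance:
  assumes "prob_space \<mu>" and [measurable]: "f \<in> \<mu> \<rightarrow>\<^sub>M X" "g \<in> \<mu> \<rightarrow>\<^sub>M E'" "r \<in> X \<rightarrow>\<^sub>M E" "K \<in> E \<rightarrow>\<^sub>M prob_algebra E'"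
    and K: "regular_cond_law \<mu> X f E' g (\<lambda>x. K (r x))"
    and [measurable]: "v\<^sub>1 \<in> borel_measurable (E \<Otimes>\<^sub>M E')" "v\<^sub>2 \<in> borel_measurable (E \<Otimes>\<^sub>M E')" "h \<in> borel_measurable X"
    and fin: "(\<integral>\<^sup>+w. v\<^sub>1 (r (f w), g w) \<partial>\<mu>) \<noteq> \<infinity>"
    and bal: "\<And>C. C \<in> sets E \<Longrightarrow> (\<integral>\<^sup>+w. indicator C (r (f w)) * v\<^sub>1 (r (f w), g w) \<partial>\<mu>) =
      (\<integral>\<^sup>+w. indicator C (r (f w)) * v\<^sub>2 (r (f w), g w) \<partial>\<mu>)"
  shows "(\<integral>\<^sup>+w. h (f w) * v\<^sub>1 (r (f w), g w) \<partial>\<mu>) = (\<integral>\<^sup>+w. h (f w) * v\<^sub>2 (r (f w), g w) \<partial>\<mu>)"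
proof -
  have [measurable]: "K \<in> E \<rightarrow>\<^sub>M subprob_algebra E'"
    by (rule measurable_prob_algebraD) fact
  have disint: "(\<integral>\<^sup>+w. k (f w) * v (r (f w), g w) \<partial>\<mu>) = (\<integral>\<^sup>+w. k (f w) * (\<integral>\<^sup>+z. v (r (f w), z) \<partial>K (r (f w))) \<partial>\<mu>)"
    if [measurable]: "k \<in> borel_measurable X" "v \<in> borel_measurable (E \<Otimes>\<^sub>M E')" for k v
  proof -
    have "(\<integral>\<^sup>+w. k (f w) * v (r (f w), g w) \<partial>\<mu>) = (\<integral>\<^sup>+w. \<integral>\<^sup>+z. k (f w) * v (r (f w), z) \<partial>K (r (f w)) \<partial>\<mu>)"
      using nn_integral_regular_cond_law[OF assms(1-3) K, of "\<lambda>(x, z). k x * v (r x, z)"] by simp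
    also have "\<dots> = (\<integral>\<^sup>+w. k (f w) * (\<integral>\<^sup>+z. v (r (f w), z) \<partial>K (r (f w))) \<partial>\<mu>)"
    proof (intro nn_integral_cong nn_integral_cmult)
      fix w assume "w \<in> space \<mu>"
      then have "r (f w) \<in> space E"
        using measurable_space[of "\<lambda>w. r (f w)" \<mu> E] by auto
      then have [measurable_cong]: "sets (K (r (f w))) = sets E'" and [simp]: "r (f w) \<in> space E"
        using subprob_measurableD(2)[of K E E'] by auto
      show "(\<lambda>z. v (r (f w), z)) \<in> borel_measurable (K (r (f w)))" by measurable
    qed
    finally show ?thesis .
  qed
  define \<rho> where "\<rho> = distr \<mu> E (\<lambda>w. r (f w))"
  define m where "m v x = (\<integral>\<^sup>+z. v (x, z) \<partial>K x)" for v x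
  have m [measurable]: "m v \<in> borel_measurable E" if [measurable]: "v \<in> borel_measurable (E \<Otimes>\<^sub>M E')" for v
    unfolding m_def by (rule nn_integral_measurable_subprob_algebra2[where N=E']) measurable
  have "density \<rho> (m v\<^sub>1) = density \<rho> (m v\<^sub>2)"
  proof (rule measure_eqI)
    fix C assume "C \<in> sets (density \<rho> (m v\<^sub>1))"
    then have [measurable]: "C \<in> sets E" by (simp add: \<rho>_def)
    have "emeasure (density \<rho> (m v)) C = (\<integral>\<^sup>+w. indicator C (r (f w)) * v (r (f w), g w) \<partial>\<mu>)"
      if [measurable]: "v \<in> borel_measurable (E \<Otimes>\<^sub>M E')" for v
      using disint[of "\<lambda>x. indicator C (r x)" v]
      by (simp add: \<rho>_def emeasure_density nn_integral_distr m_def[symmetric] mult.commute)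
    then show "emeasure (density \<rho> (m v\<^sub>1)) C = emeasure (density \<rho> (m v\<^sub>2)) C"
      using bal[of C] by simp
  qed simp
  moreover have "(\<integral>\<^sup>+x. m v\<^sub>1 x \<partial>\<rho>) \<noteq> \<infinity>"
    using disint[of "\<lambda>_. 1" v\<^sub>1] fin by (simp add: \<rho>_def nn_integral_distr m_def[symmetric])
  ultimately have "AE x in \<rho>. m v\<^sub>1 x = m v\<^sub>2 x"
    by (subst finite_density_unique[symmetric]) (auto simp: \<rho>_def)
  then have "AE w in \<mu>. m v\<^sub>1 (r (f w)) = m v\<^sub>2 (r (f w))"
    unfolding \<rho>_def by (subst (asm) AE_distr_iff) auto
  then have "(\<integral>\<^sup>+w. h (f w) * m v\<^sub>1 (r (f w)) \<partial>\<mu>) = (\<integral>\<^sup>+w. h (f w) * m v\<^sub>2 (r (f w)) \<partial>\<mu>)"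
    by (intro nn_integral_cong_AE) auto
  then show ?thesis
    by (simp add: disint m_def)
qed

text \<open>The balance lemma for the positive and the negative part of \<open>v\<close>. Nonnegative integrals
  make the disintegration applicable to the unbounded \<open>v\<close>, and integrability turns the equality of the two
  integrals into a vanishing difference.\<close>

lemma cond_law_orthogonal:
  fixes h :: "'x \<Rightarrow> real" and v :: "'e \<times> 'b \<Rightarrow> real"
  assumes "prob_space \<mu>" and [measurable]: "f \<in> \<mu> \<rightarrow>\<^sub>M X" "g \<in> \<mu> \<rightarrow>\<^sub>M E'" "r \<in> X \<rightarrow>\<^sub>M E" "K \<in> E \<rightarrow>\<^sub>M prob_algebra E'"
    and K: "regular_cond_law \<mu> X f E' g (\<lambda>x. K (r x))"
    and [measurable]: "v \<in> borel_measurable (E \<Otimes>\<^sub>M E')" "h \<in> borel_measurable X"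
    and fin: "integrable \<mu> (\<lambda>w. v (r (f w), g w))" "integrable \<mu> (\<lambda>w. h (f w) * v (r (f w), g w))"
    and bal: "\<And>C. C \<in> sets E \<Longrightarrow> (\<integral>\<^sup>+w. indicator C (r (f w)) * ennreal (v (r (f w), g w)) \<partial>\<mu>) =
      (\<integral>\<^sup>+w. indicator C (r (f w)) * ennreal (- v (r (f w), g w)) \<partial>\<mu>)"
  shows "(\<integral>w. h (f w) * v (r (f w), g w) \<partial>\<mu>) = 0"
proof -
  have "(\<integral>\<^sup>+w. ennreal (v (r (f w), g w)) \<partial>\<mu>) \<le> (\<integral>\<^sup>+w. ennreal (norm (v (r (f w), g w))) \<partial>\<mu>)"
    by (intro nn_integral_mono ennreal_leI) auto
  also have "\<dots> < \<infinity>"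
    using fin(1) by (simp add: integrable_iff_bounded)
  finally have fin': "(\<integral>\<^sup>+w. ennreal (v (r (f w), g w)) \<partial>\<mu>) \<noteq> \<infinity>" by simp
  have bal': "(\<integral>\<^sup>+w. k (f w) * ennreal (v (r (f w), g w)) \<partial>\<mu>) = (\<integral>\<^sup>+w. k (f w) * ennreal (- v (r (f w), g w)) \<partial>\<mu>)"
    if [measurable]: "k \<in> borel_measurable X" for k
    using cond_law_balance[OF assms(1-5) K, of "\<lambda>p. ennreal (v p)" "\<lambda>p. ennreal (- v p)" k] fin' bal
    by simp
  have pos: "ennreal (a * b) = ennreal a * ennreal b + ennreal (- a) * ennreal (- b)" for a b :: real
  proof (cases "0 \<le> a")
    case True
    then show ?thesis
      by (cases "a = 0") (auto simp: ennreal_mult' ennreal_neg)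
  next
    case False
    then have "ennreal (a * b) = ennreal ((- a) * (- b))" by simp
    then show ?thesis using False by (simp only: ennreal_mult') (simp add: ennreal_neg)
  qed
  have neg: "ennreal (- (a * b)) = ennreal a * ennreal (- b) + ennreal (- a) * ennreal b" for a b :: real
    using pos[of a "- b"] by simp
  have "(\<integral>\<^sup>+w. ennreal (h (f w) * v (r (f w), g w)) \<partial>\<mu>) = (\<integral>\<^sup>+w. ennreal (- (h (f w) * v (r (f w), g w))) \<partial>\<mu>)"
    unfolding pos neg
    using bal'[of "\<lambda>x. ennreal (h x)"] bal'[of "\<lambda>x. ennreal (- h x)"]
    by (simp add: nn_integral_add)
  then show ?thesis
    using fin(2) by (simp add: real_lebesgue_integral_def)
qed

section \<open>The innovation noise of a Gaussian process\<close>

lemma std_normal_moments: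
  "integrable std_normal (\<lambda>x. x)" "(\<integral>x. x \<partial>std_normal) = 0"
  "integrable std_normal (\<lambda>x. x * x)" "(\<integral>x. x * x \<partial>std_normal) = 1"
proof -
  note m = std_normal_moment_odd[of 0] std_normal_moment_even[of 1]
  show "integrable std_normal (\<lambda>x. x)" "(\<integral>x. x \<partial>std_normal) = 0"
    using m(1) unfolding std_normal_def
    by (simp_all add: integrable_density integral_density has_bochner_integral_iff)
  show "integrable std_normal (\<lambda>x. x * x)" "(\<integral>x. x * x \<partial>std_normal) = 1"
    using m(2) unfolding std_normal_def
    by (simp_all add: integrable_density integral_density has_bochner_integral_iff power2_eq_square)
qed

lemma distr_std_normal_uminus: "distr std_normal borel uminus = std_normal"
proof (rule measure_eqI)
  fix X :: "real set" assume "X \<in> sets (distr std_normal borel uminus)"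
  then have [measurable]: "X \<in> sets borel" by simp
  have "emeasure (distr std_normal borel uminus) X = (\<integral>\<^sup>+x. indicator X (- x) \<partial>std_normal)"
    by (subst nn_integral_indicator[symmetric]) (simp, subst nn_integral_distr, measurable)
  also have "\<dots> = (\<integral>\<^sup>+x. ennreal (std_normal_density x) * indicator X (- x) \<partial>lborel)"
    by (rule nn_integral_std_normal) measurable
  also have "\<dots> = (\<integral>\<^sup>+x. ennreal (std_normal_density x) * indicator X x \<partial>lborel)"
    by (subst nn_integral_real_affine[where c="-1" and t=0]) (auto simp: std_normal_density_def)
  also have "\<dots> = (\<integral>\<^sup>+x. indicator X x \<partial>std_normal)"
    by (rule nn_integral_std_normal[symmetric]) measurable
  finally show "emeasure (distr std_normal borel uminus) X = emeasure std_normal X" by simp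
qed simp

lemma product_sigma_finite_prob_space:
  "(\<And>i. prob_space (M i)) \<Longrightarrow> product_sigma_finite M"
  by (simp add: product_sigma_finite_def prob_space_imp_sigma_finite)

lemma white_noise_moments:
  assumes "i < n" "j < n"
  shows "integrable (white_noise n) (\<lambda>u. u i)" "(\<integral>u. u i \<partial>white_noise n) = 0"
    "integrable (white_noise n) (\<lambda>u. u i * u j)" "(\<integral>u. u i * u j \<partial>white_noise n) = of_bool (i = j)"
proof -
  interpret product_sigma_finite "\<lambda>_::nat. std_normal"
    by (rule product_sigma_finite_prob_space) simp
  have d: "distr (white_noise n) std_normal (\<lambda>u. u i) = std_normal"
    unfolding white_noise_def using assms by (intro distr_PiM_component) auto
  have c: "(\<lambda>u. u i) \<in> white_noise n \<rightarrow>\<^sub>M std_normal"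
    unfolding white_noise_def using assms by (intro measurable_component_singleton) auto
  show "integrable (white_noise n) (\<lambda>u. u i)"
    using integrable_distr[OF c, of "\<lambda>x. x"] std_normal_moments(1) by (simp add: d)
  show "(\<integral>u. u i \<partial>white_noise n) = 0"
    using integral_distr[OF c, of "\<lambda>x. x"] std_normal_moments(2) by (simp add: d)
  define f where "f k x = (if k = i then x else 1) * (if k = j then x else 1)" for k :: nat and x :: real
  have p: "(\<Prod>k<n. f k (u k)) = u i * u j" for u
    using assms by (simp add: f_def prod.distrib)
  have f: "integrable std_normal (f k)" "(\<integral>x. f k x \<partial>std_normal) = (if i = j then 1 else if k = i \<or> k = j then 0 else 1)" for k
    using std_normal_moments std_normal.prob_space
    by (cases "k = i"; cases "k = j"; auto simp: f_def[abs_def])+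
  show "integrable (white_noise n) (\<lambda>u. u i * u j)"
    unfolding p[symmetric] white_noise_def by (intro product_integrable_prod f) simp
  have "(\<integral>u. u i * u j \<partial>white_noise n) = (\<Prod>k<n. \<integral>x. f k x \<partial>std_normal)"
    unfolding p[symmetric] white_noise_def by (intro product_integral_prod f) simp
  also have "\<dots> = of_bool (i = j)"
    using assms unfolding f(2) by (auto simp: prod_zero_iff)
  finally show "(\<integral>u. u i * u j \<partial>white_noise n) = of_bool (i = j)" .
qed

text \<open>Each coordinate has a symmetric law and is independent of the others. Applied to the coordinate at time \<open>t\<close>, it
  shows that the noise is centred given the past before \<open>t\<close>.\<close>

lemma white_noise_flip:
  "distr (white_noise n) (path_space {..<n}) (\<lambda>u. \<lambda>k\<in>{..<n}. if k = t then - u k else u k) = white_noise n"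
proof -
  define f :: "nat \<Rightarrow> real \<Rightarrow> real" where "f k x = (if k = t then - x else x)" for k x
  have d: "distr std_normal borel (f k) = std_normal" for k
  proof (cases "k = t")
    case True
    then have "f k = uminus" by (auto simp: f_def)
    then show ?thesis by (simp add: distr_std_normal_uminus)
  next
    case False
    then have "f k = (\<lambda>x. x)" by (auto simp: f_def)
    then show ?thesis by (simp add: distr_id2)
  qed
  have [measurable]: "f k \<in> borel_measurable borel" for k
    unfolding f_def[abs_def] by measurable
  have "distr (white_noise n) (path_space {..<n}) (\<lambda>u. \<lambda>k\<in>{..<n}. f k (u k)) = PiM {..<n} (\<lambda>k. distr std_normal borel (f k))"
    unfolding white_noise_def
    by (intro distr_PiM_componentwise product_sigma_finite_prob_space) (auto simp: d)
  then show ?thesis by (simp add: d f_def white_noise_def)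
qed

lemma measurable_past: "t \<le> T \<Longrightarrow> past t \<in> path_space {..<T} \<rightarrow>\<^sub>M path_space {..<t}"
  unfolding past_def[abs_def] by (intro measurable_restrict_subset) auto

lemma measurable_future: "future T t \<in> path_space {..<T} \<rightarrow>\<^sub>M path_space {t..<T}"
  unfolding future_def[abs_def] by (intro measurable_restrict_subset) auto

lemma past_tri_map_cong:
  assumes "t \<le> n" "\<And>j. j < t \<Longrightarrow> u j = v j"
  shows "past t (tri_map n a L u) = past t (tri_map n a L v)"
  unfolding past_def tri_map_def using assms by (auto intro!: restrict_ext sum.cong)

definition tri_gaussian :: "nat \<Rightarrow> (nat \<Rightarrow> real) \<Rightarrow> (nat \<Rightarrow> nat \<Rightarrow> real) \<Rightarrow> (nat \<Rightarrow> real) measure" where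
  "tri_gaussian n a L = distr (white_noise n) (path_space {..<n}) (tri_map n a L)"

lemma sets_tri_gaussian [simp, measurable_cong]: "sets (tri_gaussian n a L) = sets (path_space {..<n})"
  by (simp add: tri_gaussian_def)

lemma prob_space_tri_gaussian: "prob_space (tri_gaussian n a L)"
  unfolding tri_gaussian_def by (intro prob_space.prob_space_distr prob_space_white_noise) measurable

text \<open>A random path \<open>X\<close> with Gaussian law on an arbitrary probability space. Both components of a coupling
  are instances, with the coupling as the probability space.\<close>

locale gaussian_process = prob_space \<pi> for \<pi> :: "'w measure" +
  fixes T :: nat and a :: "nat \<Rightarrow> real" and L :: "nat \<Rightarrow> nat \<Rightarrow> real" and X :: "'w \<Rightarrow> nat \<Rightarrow> real"
  assumes diag_pos: "\<And>i. i < T \<Longrightarrow> 0 < L i i"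
    and X_measurable [measurable]: "X \<in> \<pi> \<rightarrow>\<^sub>M path_space {..<T}"
    and law: "distr \<pi> (path_space {..<T}) X = tri_gaussian T a L"
begin

definition noise :: "nat \<Rightarrow> 'w \<Rightarrow> real" where
  "noise t w = tri_inv a L (X w) t"

lemma measurable_noise:
  "t < T \<Longrightarrow> noise t \<in> borel_measurable \<pi>"
  unfolding noise_def[abs_def]
  by (rule measurable_compose[OF X_measurable measurable_tri_inv]) auto

lemma nn_integral_law:
  assumes [measurable]: "f \<in> borel_measurable (path_space {..<T})"
  shows "(\<integral>\<^sup>+w. f (X w) \<partial>\<pi>) = (\<integral>\<^sup>+u. f (tri_map T a L u) \<partial>white_noise T)"
proof -
  have "(\<integral>\<^sup>+w. f (X w) \<partial>\<pi>) = (\<integral>\<^sup>+x. f x \<partial>tri_gaussian T a L)"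
    unfolding law[symmetric] by (simp add: nn_integral_distr)
  then show ?thesis by (simp add: tri_gaussian_def nn_integral_distr)
qed

lemma integral_law:
  fixes f :: "_ \<Rightarrow> real"
  assumes [measurable]: "f \<in> borel_measurable (path_space {..<T})"
  shows "(\<integral>w. f (X w) \<partial>\<pi>) = (\<integral>u. f (tri_map T a L u) \<partial>white_noise T)"
    and "integrable \<pi> (\<lambda>w. f (X w)) \<longleftrightarrow> integrable (white_noise T) (\<lambda>u. f (tri_map T a L u))"
proof -
  have "(\<integral>w. f (X w) \<partial>\<pi>) = (\<integral>x. f x \<partial>tri_gaussian T a L)"
    unfolding law[symmetric] by (simp add: integral_distr)
  then show "(\<integral>w. f (X w) \<partial>\<pi>) = (\<integral>u. f (tri_map T a L u) \<partial>white_noise T)"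
    by (simp add: tri_gaussian_def integral_distr)
  have "integrable \<pi> (\<lambda>w. f (X w)) \<longleftrightarrow> integrable (tri_gaussian T a L) f"
    unfolding law[symmetric] by (simp add: integrable_distr_eq)
  then show "integrable \<pi> (\<lambda>w. f (X w)) \<longleftrightarrow> integrable (white_noise T) (\<lambda>u. f (tri_map T a L u))"
    by (simp add: tri_gaussian_def integrable_distr_eq)
qed

lemma noise_moments:
  assumes "i < T" "j < T"
  shows "integrable \<pi> (noise i)" "expectation (noise i) = 0"
    "integrable \<pi> (\<lambda>w. noise i w * noise j w)"
    "expectation (\<lambda>w. noise i w * noise j w) = of_bool (i = j)"
proof -
  have [measurable]: "(\<lambda>x. tri_inv a L x i) \<in> borel_measurable (path_space {..<T})"
    "(\<lambda>x. tri_inv a L x j) \<in> borel_measurable (path_space {..<T})"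
    using assms by (auto intro!: measurable_tri_inv)
  have [simp]: "tri_inv a L (tri_map T a L u) i = u i" "tri_inv a L (tri_map T a L u) j = u j" for u
    using assms diag_pos by (auto intro!: tri_inv_tri_map simp: less_imp_neq[symmetric])
  note m = white_noise_moments[OF assms]
  show "integrable \<pi> (noise i)" "expectation (noise i) = 0"
    using integral_law[of "\<lambda>x. tri_inv a L x i"] m unfolding noise_def[abs_def] by auto
  show "integrable \<pi> (\<lambda>w. noise i w * noise j w)"
    "expectation (\<lambda>w. noise i w * noise j w) = of_bool (i = j)"
    using integral_law[of "\<lambda>x. tri_inv a L x i * tri_inv a L x j"] m unfolding noise_def[abs_def] by auto
qed

text \<open>The noise at time \<open>t\<close> is symmetric given the past before \<open>t\<close>: flipping its sign changes neither its law nor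
  the past.\<close>

lemma noise_balanced:
  assumes "t < T" and C [measurable]: "C \<in> sets (path_space {..<t})"
  shows "(\<integral>\<^sup>+w. indicator C (past t (X w)) * ennreal (noise t w) \<partial>\<pi>) =
    (\<integral>\<^sup>+w. indicator C (past t (X w)) * ennreal (- noise t w) \<partial>\<pi>)"
proof -
  have [measurable]: "past t \<in> path_space {..<T} \<rightarrow>\<^sub>M path_space {..<t}"
    using assms by (intro measurable_past) auto
  have [measurable]: "(\<lambda>x. tri_inv a L x t) \<in> borel_measurable (path_space {..<T})"
    using assms by (auto intro!: measurable_tri_inv)
  have [measurable]: "(\<lambda>u. u t) \<in> borel_measurable (path_space {..<T})"
    using assms by (intro measurable_component_singleton) auto
  have [simp]: "tri_inv a L (tri_map T a L u) t = u t" for u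
    using assms diag_pos by (auto intro!: tri_inv_tri_map simp: less_imp_neq[symmetric])
  let ?r = "\<lambda>u. \<lambda>k\<in>{..<T}. if k = t then - u k else u k :: real"
  have [measurable]: "?r \<in> white_noise T \<rightarrow>\<^sub>M path_space {..<T}"
  proof (rule measurable_restrict)
    fix k assume k: "k \<in> {..<T}"
    have "(\<lambda>u. u k) \<in> borel_measurable (path_space {..<T})"
      using k by (intro measurable_component_singleton) auto
    then show "(\<lambda>u. if k = t then - u k else u k) \<in> borel_measurable (white_noise T)"
      by (cases "k = t") simp_all
  qed
  have "(\<integral>\<^sup>+w. indicator C (past t (X w)) * ennreal (noise t w) \<partial>\<pi>) =
     (\<integral>\<^sup>+u. indicator C (past t (tri_map T a L u)) * ennreal (u t) \<partial>white_noise T)"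
    unfolding noise_def using nn_integral_law[of "\<lambda>x. indicator C (past t x) * ennreal (tri_inv a L x t)"] by simp
  also have "\<dots> = (\<integral>\<^sup>+u. indicator C (past t (tri_map T a L u)) * ennreal (u t)
      \<partial>distr (white_noise T) (path_space {..<T}) ?r)"
    by (simp only: white_noise_flip)
  also have "\<dots> = (\<integral>\<^sup>+u. indicator C (past t (tri_map T a L (?r u))) * ennreal (?r u t) \<partial>white_noise T)"
    by (rule nn_integral_distr) measurable
  also have "\<dots> = (\<integral>\<^sup>+u. indicator C (past t (tri_map T a L u)) * ennreal (- u t) \<partial>white_noise T)"
  proof (intro nn_integral_cong)
    fix u
    have "past t (tri_map T a L (?r u)) = past t (tri_map T a L u)"
      using assms by (intro past_tri_map_cong) auto
    then show "indicator C (past t (tri_map T a L (?r u))) * ennreal (?r u t) =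
       indicator C (past t (tri_map T a L u)) * ennreal (- u t)"
      using assms(1) by simp
  qed
  also have "\<dots> = (\<integral>\<^sup>+w. indicator C (past t (X w)) * ennreal (- noise t w) \<partial>\<pi>)"
    unfolding noise_def using nn_integral_law[of "\<lambda>x. indicator C (past t x) * ennreal (- tri_inv a L x t)"] by simp
  finally show ?thesis .
qed

end

section \<open>The transport cost of a bicausal coupling\<close>

lemma integrable_mult_of_squares:
  fixes f g :: "'a \<Rightarrow> real"
  assumes [measurable]: "f \<in> borel_measurable M" "g \<in> borel_measurable M"
    and "integrable M (\<lambda>x. f x * f x)" "integrable M (\<lambda>x. g x * g x)"
  shows "integrable M (\<lambda>x. f x * g x)"
proof (rule Bochner_Integration.integrable_bound)
  show "integrable M (\<lambda>x. f x * f x + g x * g x)" using assms by simp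
  have "\<bar>c * d\<bar> \<le> c * c + d * d" for c d :: real
  proof -
    have "0 \<le> (c - d)\<^sup>2" "0 \<le> (c + d)\<^sup>2" by simp_all
    then have "2 * (c * d) \<le> c * c + d * d" "- (2 * (c * d)) \<le> c * c + d * d"
      by (simp_all add: power2_eq_square algebra_simps)
    then show ?thesis by (simp add: abs_if)
  qed
  then show "AE x in M. norm (f x * g x) \<le> norm (f x * f x + g x * g x)"
    by (auto simp: abs_mult[symmetric] intro: order_trans[OF _ abs_ge_self])
qed measurable

lemma (in prob_space) expectation_square_orthogonal:
  fixes W :: "'i \<Rightarrow> 'a \<Rightarrow> real"
  assumes "finite J"
    and "\<And>j. j \<in> J \<Longrightarrow> integrable M (W j)" "\<And>j. j \<in> J \<Longrightarrow> expectation (W j) = 0"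
    and "\<And>j k. j \<in> J \<Longrightarrow> k \<in> J \<Longrightarrow> integrable M (\<lambda>w. W j w * W k w)"
    and "\<And>j k. j \<in> J \<Longrightarrow> k \<in> J \<Longrightarrow> j \<noteq> k \<Longrightarrow> expectation (\<lambda>w. W j w * W k w) = 0"
  shows "integrable M (\<lambda>w. (d + (\<Sum>j\<in>J. W j w))\<^sup>2)"
    and "expectation (\<lambda>w. (d + (\<Sum>j\<in>J. W j w))\<^sup>2) = d\<^sup>2 + (\<Sum>j\<in>J. expectation (\<lambda>w. W j w * W j w))"
proof -
  have e: "(d + (\<Sum>j\<in>J. W j w))\<^sup>2 = d\<^sup>2 + 2 * d * (\<Sum>j\<in>J. W j w) + (\<Sum>j\<in>J. \<Sum>k\<in>J. W j w * W k w)" for w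
    by (simp add: power2_eq_square algebra_simps sum_product)
  show "integrable M (\<lambda>w. (d + (\<Sum>j\<in>J. W j w))\<^sup>2)"
    unfolding e using assms by (intro Bochner_Integration.integrable_add integrable_mult_right integrable_sum) auto
  have "expectation (\<lambda>w. (d + (\<Sum>j\<in>J. W j w))\<^sup>2) =
     d\<^sup>2 + (\<Sum>j\<in>J. \<Sum>k\<in>J. expectation (\<lambda>w. W j w * W k w))"
    unfolding e using assms prob_space by (simp add: Bochner_Integration.integral_add Bochner_Integration.integral_sum)
  also have "(\<Sum>j\<in>J. \<Sum>k\<in>J. expectation (\<lambda>w. W j w * W k w)) =
     (\<Sum>j\<in>J. \<Sum>k\<in>J. if k = j then expectation (\<lambda>w. W j w * W j w) else 0)"
    using assms(5) by (intro sum.cong) auto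
  also have "\<dots> = (\<Sum>j\<in>J. expectation (\<lambda>w. W j w * W j w))"
    using assms(1) by simp
  finally show "expectation (\<lambda>w. (d + (\<Sum>j\<in>J. W j w))\<^sup>2) = d\<^sup>2 + (\<Sum>j\<in>J. expectation (\<lambda>w. W j w * W j w))" .
qed

locale gaussian_coupling =
  fixes T :: nat and a b :: "nat \<Rightarrow> real" and L M :: "nat \<Rightarrow> nat \<Rightarrow> real"
    and \<pi> :: "((nat \<Rightarrow> real) \<times> (nat \<Rightarrow> real)) measure"
  assumes L_pos: "\<And>i. i < T \<Longrightarrow> 0 < L i i" and M_pos: "\<And>i. i < T \<Longrightarrow> 0 < M i i"
    and coupling: "\<pi> \<in> couplings (tri_gaussian T a L) (tri_gaussian T b M)"
begin

lemma sets_coupling [measurable_cong]: "sets \<pi> = sets (path_space {..<T} \<Otimes>\<^sub>M path_space {..<T})"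
proof -
  have "sets \<pi> = sets (tri_gaussian T a L \<Otimes>\<^sub>M tri_gaussian T b M)"
    using coupling by (simp add: couplings_def)
  also have "\<dots> = sets (path_space {..<T} \<Otimes>\<^sub>M path_space {..<T})"
    by (intro sets_pair_measure_cong) simp_all
  finally show ?thesis .
qed

lemma space_coupling: "space \<pi> = space (path_space {..<T}) \<times> space (path_space {..<T})"
  using sets_eq_imp_space_eq[OF sets_coupling] by (simp add: space_pair_measure)

sublocale U: gaussian_process \<pi> T a L fst
proof -
  interpret prob_space \<pi> using coupling by (simp add: couplings_def)
  have "distr \<pi> (path_space {..<T}) fst = distr \<pi> (tri_gaussian T a L) fst"
    by (intro distr_cong) simp_all
  then show "gaussian_process \<pi> T a L fst"
    using coupling by unfold_locales (auto simp: couplings_def L_pos)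
qed

sublocale V: gaussian_process \<pi> T b M snd
proof -
  have "distr \<pi> (path_space {..<T}) snd = distr \<pi> (tri_gaussian T b M) snd"
    by (intro distr_cong) simp_all
  then show "gaussian_process \<pi> T b M snd"
    using coupling by unfold_locales (auto simp: couplings_def M_pos)
qed

abbreviation "U \<equiv> U.noise"
abbreviation "V \<equiv> V.noise"

definition corr :: "nat \<Rightarrow> real" where
  "corr t = U.expectation (\<lambda>w. U t w * V t w)"

lemma integrable_cross:
  assumes "i < T" "j < T"
  shows "integrable \<pi> (\<lambda>w. U i w * V j w)"
  by (rule integrable_mult_of_squares[OF U.measurable_noise V.measurable_noise U.noise_moments(3) V.noise_moments(3)])
    (use assms in simp_all)

definition cross_uncorrelated :: bool where
  "cross_uncorrelated \<longleftrightarrow> (\<forall>i<T. \<forall>j<T. i \<noteq> j \<longrightarrow> U.expectation (\<lambda>w. U i w * V j w) = 0)"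

text \<open>At each time \<open>i\<close> the difference of the paths is the constant \<open>a i - b i\<close> plus a sum of the terms
  \<open>L i j * U j - M i j * V j\<close>, which are centred and, since the noises are uncorrelated across times, pairwise
  orthogonal; so its second moment is a sum of squares.\<close>

lemma transport_cost:
  assumes cross_uncorrelated
  shows "enn2ereal (\<integral>\<^sup>+(x, y). ennreal (sq_dist T x y) \<partial>\<pi>) = ereal
    (\<Sum>i<T. (a i - b i)\<^sup>2 + (\<Sum>j\<le>i. (L i j)\<^sup>2 + (M i j)\<^sup>2 - 2 * (L i j * M i j * corr j)))"
proof -
  define W where "W i j w = L i j * U j w - M i j * V j w" for i j w
  have WW: "integrable \<pi> (\<lambda>w. W i j w * W i k w)"
    "U.expectation (\<lambda>w. W i j w * W i k w) = of_bool (j = k) * ((L i j)\<^sup>2 + (M i j)\<^sup>2 - 2 * (L i j * M i j * corr j))"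
    if "j < T" "k < T" for i j k
  proof -
    have expand: "(p * u - q * v) * (p' * u' - q' * v') = p * p' * (u * u') - p * q' * (u * v')
        - q * p' * (u' * v) + q * q' * (v * v')" for p q u v p' q' u' v' :: real
      by (simp add: algebra_simps)
    have e: "W i j w * W i k w = L i j * L i k * (U j w * U k w) - L i j * M i k * (U j w * V k w)
      - M i j * L i k * (U k w * V j w) + M i j * M i k * (V j w * V k w)" for w
      unfolding W_def by (rule expand)
    note int = U.noise_moments(3)[OF that] V.noise_moments(3)[OF that] integrable_cross[OF that]
      integrable_cross[OF that(2,1)]
    show "integrable \<pi> (\<lambda>w. W i j w * W i k w)"
      unfolding e
      by (intro Bochner_Integration.integrable_add Bochner_Integration.integrable_diff integrable_mult_right int)
    have cross: "U.expectation (\<lambda>w. U j w * V k w) = of_bool (j = k) * corr j"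
      "U.expectation (\<lambda>w. U k w * V j w) = of_bool (j = k) * corr j"
      using assms that by (auto simp: cross_uncorrelated_def corr_def)
    have "U.expectation (\<lambda>w. W i j w * W i k w) = L i j * L i k * of_bool (j = k) - L i j * M i k * (of_bool (j = k) * corr j)
      - M i j * L i k * (of_bool (j = k) * corr j) + M i j * M i k * of_bool (j = k)"
      unfolding e
      by (simp only: Bochner_Integration.integral_add Bochner_Integration.integral_diff integral_mult_right_zero
          Bochner_Integration.integrable_add Bochner_Integration.integrable_diff integrable_mult_right int
          cross U.noise_moments(4)[OF that] V.noise_moments(4)[OF that])
    then show "U.expectation (\<lambda>w. W i j w * W i k w) =
        of_bool (j = k) * ((L i j)\<^sup>2 + (M i j)\<^sup>2 - 2 * (L i j * M i j * corr j))"
      by (cases "j = k") (simp_all add: power2_eq_square)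
  qed
  have W1: "integrable \<pi> (W i j)" "U.expectation (W i j) = 0" if "j < T" for i j
    using U.noise_moments(1,2)[OF that that] V.noise_moments(1,2)[OF that that]
    unfolding W_def[abs_def] by simp_all
  have sq: "integrable \<pi> (\<lambda>w. ((a i - b i) + (\<Sum>j\<le>i. W i j w))\<^sup>2)"
    "U.expectation (\<lambda>w. ((a i - b i) + (\<Sum>j\<le>i. W i j w))\<^sup>2) =
      (a i - b i)\<^sup>2 + (\<Sum>j\<le>i. (L i j)\<^sup>2 + (M i j)\<^sup>2 - 2 * (L i j * M i j * corr j))" if "i < T" for i
  proof -
    have lt: "j < T" if "j \<in> {..i}" for j using that \<open>i < T\<close> by auto
    note orth = U.expectation_square_orthogonal[of "{..i}" "W i" "a i - b i"]
    show "integrable \<pi> (\<lambda>w. ((a i - b i) + (\<Sum>j\<le>i. W i j w))\<^sup>2)"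
      by (rule orth(1)) (use W1 WW lt in auto)
    have "U.expectation (\<lambda>w. ((a i - b i) + (\<Sum>j\<le>i. W i j w))\<^sup>2) =
      (a i - b i)\<^sup>2 + (\<Sum>j\<le>i. U.expectation (\<lambda>w. W i j w * W i j w))"
      by (rule orth(2)) (use W1 WW lt in auto)
    also have "(\<Sum>j\<le>i. U.expectation (\<lambda>w. W i j w * W i j w)) =
      (\<Sum>j\<le>i. (L i j)\<^sup>2 + (M i j)\<^sup>2 - 2 * (L i j * M i j * corr j))"
      using WW lt by (intro sum.cong) auto
    finally show "U.expectation (\<lambda>w. ((a i - b i) + (\<Sum>j\<le>i. W i j w))\<^sup>2) =
      (a i - b i)\<^sup>2 + (\<Sum>j\<le>i. (L i j)\<^sup>2 + (M i j)\<^sup>2 - 2 * (L i j * M i j * corr j))" .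
  qed
  have dist: "sq_dist T (fst w) (snd w) = (\<Sum>i<T. ((a i - b i) + (\<Sum>j\<le>i. W i j w))\<^sup>2)" for w
    unfolding sq_dist_def
  proof (intro sum.cong refl)
    fix i assume "i \<in> {..<T}"
    then have i: "i < T" by simp
    have "fst w i = a i + (\<Sum>j\<le>i. L i j * U j w)"
      using tri_map_tri_inv[of L i T a "fst w"] L_pos[OF i] i
      by (simp add: tri_map_def U.noise_def)
    moreover have "snd w i = b i + (\<Sum>j\<le>i. M i j * V j w)"
      using tri_map_tri_inv[of M i T b "snd w"] M_pos[OF i] i
      by (simp add: tri_map_def V.noise_def)
    ultimately have "fst w i - snd w i = (a i - b i) + (\<Sum>j\<le>i. W i j w)"
      by (simp add: W_def sum_subtractf)
    then show "(fst w i - snd w i)\<^sup>2 = ((a i - b i) + (\<Sum>j\<le>i. W i j w))\<^sup>2"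
      by simp
  qed
  have int: "integrable \<pi> (\<lambda>w. sq_dist T (fst w) (snd w))"
    unfolding dist using sq by (intro Bochner_Integration.integrable_sum) auto
  have "(\<integral>\<^sup>+(x, y). ennreal (sq_dist T x y) \<partial>\<pi>) = (\<integral>\<^sup>+w. ennreal (sq_dist T (fst w) (snd w)) \<partial>\<pi>)"
    by (intro nn_integral_cong) (simp add: case_prod_beta)
  also have "\<dots> = ennreal (U.expectation (\<lambda>w. sq_dist T (fst w) (snd w)))"
    using int by (intro nn_integral_eq_integral) (auto simp: sq_dist_def intro!: sum_nonneg)
  finally have "enn2ereal (\<integral>\<^sup>+(x, y). ennreal (sq_dist T x y) \<partial>\<pi>) =
      ereal (U.expectation (\<lambda>w. sq_dist T (fst w) (snd w)))"
    by (simp add: enn2ereal_ennreal integral_nonneg sq_dist_def sum_nonneg)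
  also have "U.expectation (\<lambda>w. sq_dist T (fst w) (snd w)) =
     (\<Sum>i<T. (a i - b i)\<^sup>2 + (\<Sum>j\<le>i. (L i j)\<^sup>2 + (M i j)\<^sup>2 - 2 * (L i j * M i j * corr j)))"
    unfolding dist using sq by (subst Bochner_Integration.integral_sum) auto
  finally show ?thesis .
qed

text \<open>For \<open>s < t\<close>, bicausality says that the future of one path, given the joint past before \<open>t\<close>, has a conditional
  law that depends only on its own past; \<open>cond_law_orthogonal\<close> then separates the noise at time \<open>t\<close>
  from the noise of the other path at time \<open>s\<close>. The two orders of \<open>s\<close> and \<open>t\<close> use the two marginals of
  the conditional coupling.\<close>

lemma bicausal_cross_uncorrelated:
  assumes bc: "\<pi> \<in> bicausal_couplings T (tri_gaussian T a L) (tri_gaussian T b M)"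
  shows cross_uncorrelated
proof -
  let ?E = "\<lambda>t. path_space {..<t}" and ?E' = "\<lambda>t. path_space {t..<T}"
  have key: "U.expectation (\<lambda>w. U s w * V t w) = 0 \<and> U.expectation (\<lambda>w. U t w * V s w) = 0"
    if st: "s < t" "t < T" for s t
  proof -
    have "t \<in> {1..<T}" using st by auto
    with bc obtain K1 K2 K where K1: "path_cond_law T t (tri_gaussian T a L) K1"
      and K2: "path_cond_law T t (tri_gaussian T b M) K2" and K: "pair_cond_law T t \<pi> K"
      and cpl: "AE (x, y) in \<pi>. K (past t x, past t y) \<in> couplings (K1 (past t x)) (K2 (past t y))"
      unfolding bicausal_couplings_def by blast
    have K1' [measurable]: "K1 \<in> ?E t \<rightarrow>\<^sub>M prob_algebra (?E' t)"
      and K2' [measurable]: "K2 \<in> ?E t \<rightarrow>\<^sub>M prob_algebra (?E' t)"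
      and K' [measurable]: "K \<in> ?E t \<Otimes>\<^sub>M ?E t \<rightarrow>\<^sub>M prob_algebra (?E' t \<Otimes>\<^sub>M ?E' t)"
      using K1 K2 K by (simp_all add: path_cond_law_def pair_cond_law_def regular_cond_law_def)
    note [measurable] = measurable_past[of t T, OF less_imp_le[OF st(2)]] measurable_future[of T t]
    let ?f = "map_prod (past t) (past t)"
    have f [measurable]: "?f \<in> \<pi> \<rightarrow>\<^sub>M ?E t \<Otimes>\<^sub>M ?E t"
      unfolding map_prod_def by measurable
    have fut: "future T t x \<in> space (?E' t)" if "x \<in> space (?E T)" for x
      using that by (intro measurable_space[OF measurable_future])
    have Kpair: "emeasure \<pi> {w \<in> space \<pi>. ?f w \<in> C \<and> future T t (fst w) \<in> D \<and> future T t (snd w) \<in> D'} =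
        (\<integral>\<^sup>+w. indicator C (?f w) * emeasure (K (?f w)) (D \<times> D') \<partial>\<pi>)"
      if "C \<in> sets (?E t \<Otimes>\<^sub>M ?E t)" "D \<in> sets (?E' t)" "D' \<in> sets (?E' t)" for C D D'
    proof -
      have "emeasure \<pi> {w \<in> space \<pi>. ?f w \<in> C \<and> map_prod (future T t) (future T t) w \<in> D \<times> D'} =
        (\<integral>\<^sup>+w. indicator C (?f w) * emeasure (K (?f w)) (D \<times> D') \<partial>\<pi>)"
        using K that unfolding pair_cond_law_def regular_cond_law_def by blast
      then show ?thesis by (simp add: mem_Times_iff)
    qed
    \<comment> \<open>Both marginals of the conditional coupling are read off on rectangles with one full side.\<close>
    have marg: "AE w in \<pi>. \<forall>D\<in>sets (?E' t).
        emeasure (K (?f w)) (D \<times> space (?E' t)) = emeasure (K1 (fst (?f w))) D \<and>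
        emeasure (K (?f w)) (space (?E' t) \<times> D) = emeasure (K2 (snd (?f w))) D"
      using cpl AE_space
    proof eventually_elim
      case (elim w)
      obtain x y where w: "w = (x, y)" by force
      have xy: "past t x \<in> space (?E t)" "past t y \<in> space (?E t)"
        using elim(2) measurable_space[OF measurable_past[of t T]] st
        by (auto simp: w space_coupling)
      have S1 [measurable_cong]: "sets (K1 (past t x)) = sets (?E' t)"
        and S2 [measurable_cong]: "sets (K2 (past t y)) = sets (?E' t)"
        using measurable_space[OF K1' xy(1)] measurable_space[OF K2' xy(2)] by (simp_all add: space_prob_algebra)
      let ?K = "K (past t x, past t y)"
      have c: "sets ?K = sets (K1 (past t x) \<Otimes>\<^sub>M K2 (past t y))"
        "distr ?K (K1 (past t x)) fst = K1 (past t x)" "distr ?K (K2 (past t y)) snd = K2 (past t y)"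
        using elim(1) by (simp_all add: w couplings_def)
      have sp: "space ?K = space (?E' t) \<times> space (?E' t)"
        using sets_eq_imp_space_eq[OF c(1)] sets_eq_imp_space_eq[OF S1] sets_eq_imp_space_eq[OF S2]
        by (simp add: space_pair_measure)
      have m: "fst \<in> ?K \<rightarrow>\<^sub>M K1 (past t x)" "snd \<in> ?K \<rightarrow>\<^sub>M K2 (past t y)"
        by (simp_all add: measurable_cong_sets[OF c(1) refl])
      show ?case
      proof (intro ballI conjI)
        fix D assume D: "D \<in> sets (?E' t)"
        then have D': "D \<subseteq> space (?E' t)" by (rule sets.sets_into_space)
        have "emeasure (K1 (past t x)) D = emeasure (distr ?K (K1 (past t x)) fst) D" by (simp add: c(2))
        also have "\<dots> = emeasure ?K (fst -` D \<inter> space ?K)"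
          using D S1 by (intro emeasure_distr m) auto
        also have "fst -` D \<inter> space ?K = D \<times> space (?E' t)" using D' by (auto simp: sp)
        finally show "emeasure (K (?f w)) (D \<times> space (?E' t)) = emeasure (K1 (fst (?f w))) D"
          by (simp add: w)
        have "emeasure (K2 (past t y)) D = emeasure (distr ?K (K2 (past t y)) snd) D" by (simp add: c(3))
        also have "\<dots> = emeasure ?K (snd -` D \<inter> space ?K)"
          using D S2 by (intro emeasure_distr m) auto
        also have "snd -` D \<inter> space ?K = space (?E' t) \<times> D" using D' by (auto simp: sp)
        finally show "emeasure (K (?f w)) (space (?E' t) \<times> D) = emeasure (K2 (snd (?f w))) D"
          by (simp add: w)
      qed
    qed
    have C1: "regular_cond_law \<pi> (?E t \<Otimes>\<^sub>M ?E t) ?f (?E' t) (\<lambda>w. future T t (fst w)) (\<lambda>p. K1 (fst p))"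
      unfolding regular_cond_law_def
    proof (intro conjI ballI)
      fix C D assume CD: "C \<in> sets (?E t \<Otimes>\<^sub>M ?E t)" "D \<in> sets (?E' t)"
      have "emeasure \<pi> {w \<in> space \<pi>. ?f w \<in> C \<and> future T t (fst w) \<in> D} =
         emeasure \<pi> {w \<in> space \<pi>. ?f w \<in> C \<and> future T t (fst w) \<in> D \<and> future T t (snd w) \<in> space (?E' t)}"
        using fut by (intro arg_cong2[where f = emeasure]) (auto simp: space_coupling)
      also have "\<dots> = (\<integral>\<^sup>+w. indicator C (?f w) * emeasure (K (?f w)) (D \<times> space (?E' t)) \<partial>\<pi>)"
        using CD by (intro Kpair) auto
      also have "\<dots> = (\<integral>\<^sup>+w. indicator C (?f w) * emeasure (K1 (fst (?f w))) D \<partial>\<pi>)"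
        using marg CD by (intro nn_integral_cong_AE) (auto elim: eventually_mono)
      finally show "emeasure \<pi> {w \<in> space \<pi>. ?f w \<in> C \<and> future T t (fst w) \<in> D} =
         (\<integral>\<^sup>+w. indicator C (?f w) * emeasure (K1 (fst (?f w))) D \<partial>\<pi>)" .
    qed measurable
    have C2: "regular_cond_law \<pi> (?E t \<Otimes>\<^sub>M ?E t) ?f (?E' t) (\<lambda>w. future T t (snd w)) (\<lambda>p. K2 (snd p))"
      unfolding regular_cond_law_def
    proof (intro conjI ballI)
      fix C D assume CD: "C \<in> sets (?E t \<Otimes>\<^sub>M ?E t)" "D \<in> sets (?E' t)"
      have "emeasure \<pi> {w \<in> space \<pi>. ?f w \<in> C \<and> future T t (snd w) \<in> D} =
         emeasure \<pi> {w \<in> space \<pi>. ?f w \<in> C \<and> future T t (fst w) \<in> space (?E' t) \<and> future T t (snd w) \<in> D}"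
        using fut by (intro arg_cong2[where f = emeasure]) (auto simp: space_coupling)
      also have "\<dots> = (\<integral>\<^sup>+w. indicator C (?f w) * emeasure (K (?f w)) (space (?E' t) \<times> D) \<partial>\<pi>)"
        using CD by (intro Kpair) auto
      also have "\<dots> = (\<integral>\<^sup>+w. indicator C (?f w) * emeasure (K2 (snd (?f w))) D \<partial>\<pi>)"
        using marg CD by (intro nn_integral_cong_AE) (auto elim: eventually_mono)
      finally show "emeasure \<pi> {w \<in> space \<pi>. ?f w \<in> C \<and> future T t (snd w) \<in> D} =
         (\<integral>\<^sup>+w. indicator C (?f w) * emeasure (K2 (snd (?f w))) D \<partial>\<pi>)" .
    qed measurable
    \<comment> \<open>The noise at time \<open>t\<close> as a function of the past before \<open>t\<close> and the future from \<open>t\<close> on.\<close>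
    define inn where "inn c N p = tri_inv c N (merge {..<t} {t..<T} p) t"
      for c :: "nat \<Rightarrow> real" and N and p :: "(nat \<Rightarrow> real) \<times> (nat \<Rightarrow> real)"
    have "{..<t} \<union> {t..<T} = {..<T}" using st by auto
    then have mrg: "merge {..<t} {t..<T} \<in> ?E t \<Otimes>\<^sub>M ?E' t \<rightarrow>\<^sub>M ?E T"
      using measurable_merge[of "{..<t}" "{t..<T}" "\<lambda>_. borel"] by simp
    have [measurable]: "inn c N \<in> borel_measurable (?E t \<Otimes>\<^sub>M ?E' t)" for c N
      unfolding inn_def[abs_def] using st
      by (intro measurable_compose[OF mrg measurable_tri_inv]) auto
    have inn: "inn c N (past t x, future T t x) = tri_inv c N x t" for c N x
      unfolding inn_def using st
      by (intro tri_inv_cong) (auto simp: merge_def past_def future_def)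
    have old: "tri_inv c N (past t x) s = tri_inv c N x s" for c N x
      using st by (intro tri_inv_cong) (auto simp: past_def)
    have [measurable]: "(\<lambda>p. tri_inv c N p s) \<in> borel_measurable (?E t)" for c N
      using st by (intro measurable_tri_inv) auto
    have sT: "s < T" using st by simp
    have "U.expectation (\<lambda>w. (\<lambda>p. tri_inv a L (fst p) s) (?f w) * inn b M (snd (?f w), future T t (snd w))) = 0"
    proof (rule cond_law_orthogonal[where f = ?f and X = "?E t \<Otimes>\<^sub>M ?E t" and E = "?E t" and E' = "?E' t"
          and K = K2 and r = snd and g = "\<lambda>w. future T t (snd w)"])
      show "integrable \<pi> (\<lambda>w. inn b M (snd (?f w), future T t (snd w)))"
        using V.noise_moments(1)[OF st(2) st(2)] by (simp add: inn V.noise_def[abs_def])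
      show "integrable \<pi> (\<lambda>w. tri_inv a L (fst (?f w)) s * inn b M (snd (?f w), future T t (snd w)))"
        using integrable_cross[OF sT st(2)] by (simp add: inn old V.noise_def[abs_def] U.noise_def[abs_def])
      fix C assume "C \<in> sets (?E t)"
      from V.noise_balanced[OF st(2) this]
      show "(\<integral>\<^sup>+w. indicator C (snd (?f w)) * ennreal (inn b M (snd (?f w), future T t (snd w))) \<partial>\<pi>) =
        (\<integral>\<^sup>+w. indicator C (snd (?f w)) * ennreal (- inn b M (snd (?f w), future T t (snd w))) \<partial>\<pi>)"
        by (simp add: inn V.noise_def)
    qed (use C1 C2 K1' K2' in \<open>simp_all add: U.prob_space_axioms\<close>)
    moreover have "U.expectation (\<lambda>w. (\<lambda>p. tri_inv b M (snd p) s) (?f w) * inn a L (fst (?f w), future T t (fst w))) = 0"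
    proof (rule cond_law_orthogonal[where f = ?f and X = "?E t \<Otimes>\<^sub>M ?E t" and E = "?E t" and E' = "?E' t"
          and K = K1 and r = fst and g = "\<lambda>w. future T t (fst w)"])
      show "integrable \<pi> (\<lambda>w. inn a L (fst (?f w), future T t (fst w)))"
        using U.noise_moments(1)[OF st(2) st(2)] by (simp add: inn U.noise_def[abs_def])
      show "integrable \<pi> (\<lambda>w. tri_inv b M (snd (?f w)) s * inn a L (fst (?f w), future T t (fst w)))"
        using integrable_cross[OF st(2) sT]
        by (simp add: inn old V.noise_def[abs_def] U.noise_def[abs_def] mult.commute)
      fix C assume "C \<in> sets (?E t)"
      from U.noise_balanced[OF st(2) this]
      show "(\<integral>\<^sup>+w. indicator C (fst (?f w)) * ennreal (inn a L (fst (?f w), future T t (fst w))) \<partial>\<pi>) =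
        (\<integral>\<^sup>+w. indicator C (fst (?f w)) * ennreal (- inn a L (fst (?f w), future T t (fst w))) \<partial>\<pi>)"
        by (simp add: inn U.noise_def)
    qed (use C1 C2 K1' K2' in \<open>simp_all add: U.prob_space_axioms\<close>)
    ultimately show ?thesis
      by (simp add: inn old V.noise_def U.noise_def mult.commute)
  qed
  show ?thesis
    unfolding cross_uncorrelated_def using key by (metis nat_neq_iff)
qed

end

section \<open>Relative entropy against a test density\<close>

text \<open>Gibbs' inequality. With \<open>r = dP/dR\<close>, integrate \<open>ln (q / r) \<le> q / r - 1\<close> against \<open>P\<close>; the integral
  of \<open>q / r\<close> is at most the \<open>R\<close>-integral of \<open>q\<close>, hence at most \<open>1\<close>.\<close>

lemma KL_ge_integral_ln:
  assumes P: "prob_space P" and R: "prob_space R" and sets [measurable_cong]: "sets P = sets R"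
    and [measurable]: "q \<in> borel_measurable R" and q_pos: "\<And>x. 0 < q x"
    and q_le: "(\<integral>\<^sup>+x. ennreal (q x) \<partial>R) \<le> 1" and int: "integrable P (\<lambda>x. ln (q x))"
  shows "ereal (\<integral>x. ln (q x) \<partial>P) \<le> KL P R"
proof (cases "absolutely_continuous R P \<and> integrable P (entropy_density (exp 1) R P)")
  case True
  interpret P: prob_space P by fact
  interpret R: prob_space R by fact
  define r where "r x = enn2real (RN_deriv R P x)" for x
  have [measurable]: "r \<in> borel_measurable R" unfolding r_def[abs_def] by measurable
  have dens: "density R (RN_deriv R P) = P"
    using True sets by (intro R.density_RN_deriv) auto
  have ent: "entropy_density (exp 1) R P = (\<lambda>x. ln (r x))"
    by (auto simp: entropy_density_def r_def log_def)
  have "AE x in R. RN_deriv R P x \<noteq> \<infinity>"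
    using True sets by (intro R.RN_deriv_finite P.sigma_finite_measure_axioms) auto
  then have "AE x in density R (RN_deriv R P). 0 < r x"
    by (subst AE_density) (auto elim!: eventually_mono simp: r_def enn2real_positive_iff top.not_eq_extremum)
  then have r_pos: "AE x in P. 0 < r x" by (simp only: dens)
  have "(\<integral>\<^sup>+x. ennreal (q x / r x) \<partial>P) = (\<integral>\<^sup>+x. ennreal (q x / r x) \<partial>density R (RN_deriv R P))"
    by (simp only: dens)
  also have "\<dots> = (\<integral>\<^sup>+x. RN_deriv R P x * ennreal (q x / r x) \<partial>R)"
    by (intro nn_integral_density) measurable
  also have "\<dots> \<le> (\<integral>\<^sup>+x. ennreal (q x) \<partial>R)"
  proof (intro nn_integral_mono)
    fix x
    show "RN_deriv R P x * ennreal (q x / r x) \<le> ennreal (q x)"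
    proof (cases "RN_deriv R P x")
      case (real s)
      then have "r x = s" "RN_deriv R P x = ennreal s" by (simp_all add: r_def)
      then have "RN_deriv R P x * ennreal (q x / r x) = ennreal (s * (q x / s))"
        by (simp only: ennreal_mult'[OF real(1)])
      also have "\<dots> \<le> ennreal (q x)"
        using q_pos[of x] by (intro ennreal_leI) auto
      finally show ?thesis .
    next
      case top
      then show ?thesis by (simp add: r_def)
    qed
  qed
  also note q_le
  finally have qr: "(\<integral>\<^sup>+x. ennreal (q x / r x) \<partial>P) \<le> 1" .
  have nonneg: "0 \<le> q x / r x" for x using q_pos[of x] by (simp add: r_def)
  have qr_int: "integrable P (\<lambda>x. q x / r x)"
    using qr nonneg by (intro integrableI_nonneg) (auto simp: less_le_trans top.not_eq_extremum intro: le_less_trans)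
  then have "ennreal (\<integral>x. q x / r x \<partial>P) \<le> 1"
    using qr nonneg by (simp add: nn_integral_eq_integral)
  then have qr_le: "(\<integral>x. q x / r x \<partial>P) \<le> 1" by simp
  have ent_int: "integrable P (\<lambda>x. ln (r x))" using True by (simp add: ent)
  have "(\<integral>x. ln (q x) \<partial>P) \<le> (\<integral>x. ln (r x) + (q x / r x - 1) \<partial>P)"
  proof (intro integral_mono_AE int)
    show "integrable P (\<lambda>x. ln (r x) + (q x / r x - 1))" using ent_int qr_int by simp
    show "AE x in P. ln (q x) \<le> ln (r x) + (q x / r x - 1)"
      using r_pos
    proof eventually_elim
      case (elim x)
      then have "ln (q x / r x) \<le> q x / r x - 1" using q_pos[of x] by (intro ln_le_minus_one) simp
      moreover have "ln (q x / r x) = ln (q x) - ln (r x)" using elim q_pos[of x] by (simp add: ln_div)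
      ultimately show ?case by simp
    qed
  qed
  also have "\<dots> = (\<integral>x. ln (r x) \<partial>P) + ((\<integral>x. q x / r x \<partial>P) - 1)"
    using ent_int qr_int P.prob_space by simp
  also have "\<dots> \<le> (\<integral>x. ln (r x) \<partial>P)" using qr_le by simp
  finally show ?thesis
    using True by (simp add: KL_def KL_divergence_def ent)
next
  case False
  then show ?thesis unfolding KL_def by (simp only: if_False) simp
qed

lemma KL_density_eq:
  assumes R: "prob_space R" and P: "P = density R (\<lambda>x. ennreal (q x))"
    and [measurable]: "q \<in> borel_measurable R" and q_pos: "\<And>x. 0 < q x"
    and int: "integrable P (\<lambda>x. ln (q x))"
  shows "KL P R = ereal (\<integral>x. ln (q x) \<partial>P)"
proof -
  interpret R: prob_space R by fact
  have ac: "absolutely_continuous R P"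
    unfolding P by (rule absolutely_continuousI_density) measurable
  have [measurable_cong]: "sets P = sets R" by (simp add: P)
  have "AE x in R. RN_deriv R P x = ennreal (q x)"
    using R.RN_deriv_unique[OF _ P[symmetric]] by (auto elim: eventually_mono)
  then have "AE x in P. RN_deriv R P x = ennreal (q x)"
    using ac by (intro absolutely_continuous_AE[OF _ ac]) (simp_all add: P)
  then have ent: "AE x in P. entropy_density (exp 1) R P x = ln (q x)"
    by eventually_elim (use q_pos in \<open>auto simp: entropy_density_def log_def less_imp_le\<close>)
  have [measurable]: "entropy_density (exp 1) R P \<in> borel_measurable P"
    by measurable
  have "integrable P (entropy_density (exp 1) R P)"
    using int ent by (subst integrable_cong_AE) auto
  moreover have "KL_divergence (exp 1) R P = (\<integral>x. ln (q x) \<partial>P)"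
    unfolding KL_divergence_def using ent by (intro integral_cong_AE) auto
  ultimately show ?thesis using ac by (simp add: KL_def)
qed

section \<open>Correlated pairs of standard normal variables\<close>

text \<open>The density of the bivariate standard normal law with correlation \<open>p\<close> relative to the product of its
  marginals.\<close>

definition corr_density :: "real \<Rightarrow> real \<Rightarrow> real \<Rightarrow> real" where
  "corr_density p u v =
    exp ((p * (u * v) - p\<^sup>2 / 2 * (u * u + v * v)) / (1 - p\<^sup>2)) / sqrt (1 - p\<^sup>2)"

lemma measurable_corr_density [measurable (raw)]:
  assumes [measurable]: "f \<in> borel_measurable M" "g \<in> borel_measurable M"
  shows "(\<lambda>x. corr_density p (f x) (g x)) \<in> borel_measurable M"
  unfolding corr_density_def by measurable

lemma corr_density_pos: "\<bar>p\<bar> < 1 \<Longrightarrow> 0 < corr_density p u v"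
  by (simp add: corr_density_def abs_square_less_1)

lemma corr_density_commute: "corr_density p u v = corr_density p v u"
  by (simp add: corr_density_def mult.commute add.commute)

lemma ln_corr_density:
  assumes "\<bar>p\<bar> < 1"
  shows "ln (corr_density p u v) = - ln (1 - p\<^sup>2) / 2 +
     (p * (u * v) - p\<^sup>2 / 2 * (u * u + v * v)) / (1 - p\<^sup>2)"
proof -
  have "0 < 1 - p\<^sup>2" using assms by (simp add: abs_square_less_1)
  then show ?thesis by (simp add: corr_density_def ln_div ln_sqrt)
qed

text \<open>Given \<open>u\<close>, the second component of a pair with correlation \<open>p\<close> is normal with mean \<open>p * u\<close> and variance
  \<open>1 - p\<^sup>2\<close>; completing the square in the exponent identifies its density relative to the standard normal
  law.\<close>

lemma nn_integral_affine_std_normal: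
  assumes p: "\<bar>p\<bar> < 1" and [measurable]: "f \<in> borel_measurable borel"
  shows "(\<integral>\<^sup>+w. f (p * u + sqrt (1 - p\<^sup>2) * w) \<partial>std_normal) =
    (\<integral>\<^sup>+v. ennreal (corr_density p u v) * f v \<partial>std_normal)"
proof -
  define s where "s = sqrt (1 - p\<^sup>2)"
  have p1: "0 < 1 - p\<^sup>2" using p by (simp add: abs_square_less_1)
  then have s: "0 < s" "s\<^sup>2 = 1 - p\<^sup>2" by (simp_all add: s_def)
  have key: "s * (corr_density p u (p * u + s * w) * std_normal_density (p * u + s * w)) = std_normal_density w" for w
  proof -
    let ?v = "p * u + s * w"
    have "(p * (u * ?v) - p\<^sup>2 / 2 * (u * u + ?v * ?v)) / (1 - p\<^sup>2) + - (?v\<^sup>2) / 2 =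
       ((p * (u * ?v) - p\<^sup>2 / 2 * (u * u + ?v * ?v)) - (1 - p\<^sup>2) * ?v\<^sup>2 / 2) / (1 - p\<^sup>2)"
      using p1 by (simp add: field_simps)
    also have "(p * (u * ?v) - p\<^sup>2 / 2 * (u * u + ?v * ?v)) - (1 - p\<^sup>2) * ?v\<^sup>2 / 2 = - (?v - p * u)\<^sup>2 / 2"
      by (simp add: power2_eq_square field_simps)
    also have "- (?v - p * u)\<^sup>2 / 2 / (1 - p\<^sup>2) = - w\<^sup>2 / 2"
      using s(1) unfolding s(2)[symmetric] by (simp add: power_mult_distrib)
    finally have e: "exp ((p * (u * ?v) - p\<^sup>2 / 2 * (u * u + ?v * ?v)) / (1 - p\<^sup>2)) * exp (- (?v\<^sup>2) / 2) = exp (- w\<^sup>2 / 2)"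
      by (simp only: exp_add[symmetric])
    have "s * (corr_density p u ?v * std_normal_density ?v) =
      (s / s) * (1 / sqrt (2 * pi)) * (exp ((p * (u * ?v) - p\<^sup>2 / 2 * (u * u + ?v * ?v)) / (1 - p\<^sup>2)) * exp (- (?v\<^sup>2) / 2))"
      by (simp add: corr_density_def std_normal_density_def s_def)
    also have "\<dots> = std_normal_density w"
      unfolding e using s by (simp add: std_normal_density_def)
    finally show ?thesis .
  qed
  have "(\<integral>\<^sup>+v. ennreal (corr_density p u v) * f v \<partial>std_normal) =
      (\<integral>\<^sup>+v. ennreal (std_normal_density v) * (ennreal (corr_density p u v) * f v) \<partial>lborel)"
    by (rule nn_integral_std_normal) measurable
  also have "\<dots> = ennreal s * (\<integral>\<^sup>+w. ennreal (std_normal_density (p * u + s * w)) *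
      (ennreal (corr_density p u (p * u + s * w)) * f (p * u + s * w)) \<partial>lborel)"
    using s by (subst nn_integral_real_affine[where c=s and t="p * u"]) auto
  also have "\<dots> = (\<integral>\<^sup>+w. ennreal s * (ennreal (std_normal_density (p * u + s * w)) *
      (ennreal (corr_density p u (p * u + s * w)) * f (p * u + s * w))) \<partial>lborel)"
    by (rule nn_integral_cmult[symmetric]) measurable
  also have "\<dots> = (\<integral>\<^sup>+w. ennreal (std_normal_density w) * f (p * u + s * w) \<partial>lborel)"
  proof (intro nn_integral_cong)
    fix w
    have "ennreal s * (ennreal (std_normal_density (p * u + s * w)) * (ennreal (corr_density p u (p * u + s * w)) * f (p * u + s * w)))
      = ennreal (s * (corr_density p u (p * u + s * w) * std_normal_density (p * u + s * w))) * f (p * u + s * w)"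
      using s corr_density_pos[OF p] by (simp add: ennreal_mult less_imp_le mult_ac)
    then show "ennreal s * (ennreal (std_normal_density (p * u + s * w)) * (ennreal (corr_density p u (p * u + s * w)) * f (p * u + s * w)))
      = ennreal (std_normal_density w) * f (p * u + s * w)" by (simp only: key)
  qed
  also have "\<dots> = (\<integral>\<^sup>+w. f (p * u + s * w) \<partial>std_normal)"
    by (rule nn_integral_std_normal[symmetric]) measurable
  finally show ?thesis by (simp add: s_def)
qed

text \<open>Defined by sampling, so that \<open>\<bar>p\<bar> = 1\<close>, where the law has no density, is included.\<close>

definition corr_pair :: "real \<Rightarrow> (real \<times> real) measure" where
  "corr_pair p = distr (std_normal \<Otimes>\<^sub>M std_normal) (borel \<Otimes>\<^sub>M borel) (\<lambda>(u, w). (u, p * u + sqrt (1 - p\<^sup>2) * w))"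

interpretation std_normal_pair: pair_prob_space std_normal std_normal ..

lemma sets_std_normal_pair [measurable_cong]: "sets (std_normal \<Otimes>\<^sub>M std_normal) = sets (borel \<Otimes>\<^sub>M borel)"
  by (intro sets_pair_measure_cong) simp_all

lemma sets_corr_pair [simp, measurable_cong]: "sets (corr_pair p) = sets (borel \<Otimes>\<^sub>M borel)"
  by (simp add: corr_pair_def)

lemma space_corr_pair [simp]: "space (corr_pair p) = UNIV"
  by (simp add: corr_pair_def space_pair_measure)

lemma prob_space_corr_pair [simp]: "prob_space (corr_pair p)"
  unfolding corr_pair_def by (intro std_normal_pair.prob_space_distr) measurable

lemma nn_integral_corr_pair:
  assumes [measurable]: "f \<in> borel_measurable (borel \<Otimes>\<^sub>M borel)"
  shows "(\<integral>\<^sup>+z. f z \<partial>corr_pair p) = (\<integral>\<^sup>+u. \<integral>\<^sup>+w. f (u, p * u + sqrt (1 - p\<^sup>2) * w) \<partial>std_normal \<partial>std_normal)"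
proof -
  have "(\<integral>\<^sup>+z. f z \<partial>corr_pair p) = (\<integral>\<^sup>+(u, w). f (u, p * u + sqrt (1 - p\<^sup>2) * w) \<partial>(std_normal \<Otimes>\<^sub>M std_normal))"
    unfolding corr_pair_def by (subst nn_integral_distr) (auto simp: case_prod_beta intro!: nn_integral_cong)
  also have "\<dots> = (\<integral>\<^sup>+u. \<integral>\<^sup>+w. f (u, p * u + sqrt (1 - p\<^sup>2) * w) \<partial>std_normal \<partial>std_normal)"
    by (subst std_normal.nn_integral_fst[symmetric]) auto
  finally show ?thesis .
qed

lemma corr_pair_eq_density:
  assumes p: "\<bar>p\<bar> < 1"
  shows "corr_pair p = density (std_normal \<Otimes>\<^sub>M std_normal) (\<lambda>(u, v). ennreal (corr_density p u v))"
proof (rule measure_eqI)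
  show "sets (corr_pair p) = sets (density (std_normal \<Otimes>\<^sub>M std_normal) (\<lambda>(u, v). ennreal (corr_density p u v)))"
    by (simp add: sets_std_normal_pair)
  fix X assume "X \<in> sets (corr_pair p)"
  then have [measurable]: "X \<in> sets (borel \<Otimes>\<^sub>M borel)" by simp
  have "emeasure (corr_pair p) X = (\<integral>\<^sup>+z. indicator X z \<partial>corr_pair p)" by simp
  also have "\<dots> = (\<integral>\<^sup>+u. \<integral>\<^sup>+w. indicator X (u, p * u + sqrt (1 - p\<^sup>2) * w) \<partial>std_normal \<partial>std_normal)"
    by (rule nn_integral_corr_pair) measurable
  also have "\<dots> = (\<integral>\<^sup>+u. \<integral>\<^sup>+v. ennreal (corr_density p u v) * indicator X (u, v) \<partial>std_normal \<partial>std_normal)"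
    by (intro nn_integral_cong nn_integral_affine_std_normal p) measurable
  also have "\<dots> = (\<integral>\<^sup>+z. (case z of (u, v) \<Rightarrow> ennreal (corr_density p u v)) * indicator X z \<partial>(std_normal \<Otimes>\<^sub>M std_normal))"
    by (subst std_normal.nn_integral_fst[symmetric]) (auto simp: case_prod_beta)
  also have "\<dots> = emeasure (density (std_normal \<Otimes>\<^sub>M std_normal) (\<lambda>(u, v). ennreal (corr_density p u v))) X"
    by (subst emeasure_density) (auto simp: sets_std_normal_pair)
  finally show "emeasure (corr_pair p) X = emeasure (density (std_normal \<Otimes>\<^sub>M std_normal) (\<lambda>(u, v). ennreal (corr_density p u v))) X" .
qed

lemma distr_corr_pair_fst: "distr (corr_pair p) borel fst = std_normal"
proof (rule measure_eqI)
  fix X :: "real set" assume "X \<in> sets (distr (corr_pair p) borel fst)"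
  then have [measurable]: "X \<in> sets borel" by simp
  have "emeasure (distr (corr_pair p) borel fst) X = (\<integral>\<^sup>+z. indicator X (fst z) \<partial>corr_pair p)"
    by (subst nn_integral_indicator[symmetric]) (simp, subst nn_integral_distr, measurable)
  also have "\<dots> = (\<integral>\<^sup>+u. indicator X u \<partial>std_normal)"
    by (subst nn_integral_corr_pair) (auto simp: std_normal.emeasure_space_1[simplified])
  finally show "emeasure (distr (corr_pair p) borel fst) X = emeasure std_normal X" by simp
qed simp

text \<open>For \<open>\<bar>p\<bar> < 1\<close> the symmetry of the density in its two arguments reduces this to the fact that it integrates to
  \<open>1\<close> in the second argument; for \<open>\<bar>p\<bar> = 1\<close> the second component is \<open>\<plusminus>\<close> the first.\<close>

lemma distr_corr_pair_snd:
  assumes "\<bar>p\<bar> \<le> 1"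
  shows "distr (corr_pair p) borel snd = std_normal"
proof (cases "\<bar>p\<bar> = 1")
  case True
  have "distr (corr_pair p) borel snd = distr (std_normal \<Otimes>\<^sub>M std_normal) borel (\<lambda>z. p * fst z)"
  proof -
    have "p\<^sup>2 = 1" using True by (metis one_power2 power2_abs)
    then show ?thesis
      unfolding corr_pair_def by (subst distr_distr) (auto simp: comp_def case_prod_beta)
  qed
  also have "\<dots> = distr (distr (std_normal \<Otimes>\<^sub>M std_normal) std_normal fst) borel (\<lambda>u. p * u)"
    by (subst distr_distr) (auto simp: comp_def)
  also have "distr (std_normal \<Otimes>\<^sub>M std_normal) std_normal fst = std_normal"
    by (rule std_normal.distr_pair_fst)
  also have "distr std_normal borel (\<lambda>u. p * u) = std_normal"
    using True distr_std_normal_uminus by (auto simp: abs_if distr_id2 split: if_splits)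
  finally show ?thesis .
next
  case False
  then have p: "\<bar>p\<bar> < 1" using assms by simp
  show ?thesis
  proof (rule measure_eqI)
    fix X :: "real set" assume "X \<in> sets (distr (corr_pair p) borel snd)"
    then have [measurable]: "X \<in> sets borel" by simp
    have one: "(\<integral>\<^sup>+u. ennreal (corr_density p u v) \<partial>std_normal) = 1" for v
      using nn_integral_affine_std_normal[OF p, of "\<lambda>_. 1" v]
      by (simp add: corr_density_commute[of p v] std_normal.emeasure_space_1[simplified])
    have "emeasure (distr (corr_pair p) borel snd) X = (\<integral>\<^sup>+z. indicator X (snd z) \<partial>corr_pair p)"
      by (subst nn_integral_indicator[symmetric]) (simp, subst nn_integral_distr, measurable)
    also have "\<dots> = (\<integral>\<^sup>+u. \<integral>\<^sup>+w. indicator X (p * u + sqrt (1 - p\<^sup>2) * w) \<partial>std_normal \<partial>std_normal)"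
      by (subst nn_integral_corr_pair) auto
    also have "\<dots> = (\<integral>\<^sup>+u. \<integral>\<^sup>+v. ennreal (corr_density p u v) * indicator X v \<partial>std_normal \<partial>std_normal)"
      by (intro nn_integral_cong nn_integral_affine_std_normal p) measurable
    also have "\<dots> = (\<integral>\<^sup>+v. \<integral>\<^sup>+u. ennreal (corr_density p u v) * indicator X v \<partial>std_normal \<partial>std_normal)"
      by (rule std_normal_pair.Fubini'[symmetric]) measurable
    also have "\<dots> = (\<integral>\<^sup>+v. (\<integral>\<^sup>+u. ennreal (corr_density p u v) \<partial>std_normal) * indicator X v \<partial>std_normal)"
      by (intro nn_integral_cong nn_integral_multc) measurable
    also have "\<dots> = (\<integral>\<^sup>+v. indicator X v \<partial>std_normal)"
      by (simp add: one)
    finally show "emeasure (distr (corr_pair p) borel snd) X = emeasure std_normal X" by simp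
  qed simp
qed

lemma corr_pair_covariance: "(\<integral>z. fst z * snd z \<partial>corr_pair p) = p"
proof -
  have i: "integrable (std_normal \<Otimes>\<^sub>M std_normal) (\<lambda>z. fst z * fst z)"
    "(\<integral>z. fst z * fst z \<partial>(std_normal \<Otimes>\<^sub>M std_normal)) = 1"
    "integrable (std_normal \<Otimes>\<^sub>M std_normal) (\<lambda>z. snd z * snd z)"
  proof -
    have m: "fst \<in> std_normal \<Otimes>\<^sub>M std_normal \<rightarrow>\<^sub>M std_normal"
      by simp
    have d: "distr (std_normal \<Otimes>\<^sub>M std_normal) std_normal fst = std_normal"
      by (rule std_normal.distr_pair_fst)
    show fst2: "integrable (std_normal \<Otimes>\<^sub>M std_normal) (\<lambda>z. fst z * fst z)"
      using integrable_distr[OF m, of "\<lambda>x. x * x"] std_normal_moments(3) by (simp add: d)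
    show "(\<integral>z. fst z * fst z \<partial>(std_normal \<Otimes>\<^sub>M std_normal)) = 1"
      using integral_distr[OF m, of "\<lambda>x. x * x"] std_normal_moments(4) by (simp add: d)
    show "integrable (std_normal \<Otimes>\<^sub>M std_normal) (\<lambda>z. snd z * snd z)"
      using std_normal_pair.integrable_product_swap[OF fst2] by (simp add: split_beta')
  qed
  have uw: "integrable (std_normal \<Otimes>\<^sub>M std_normal) (\<lambda>z. fst z * snd z)"
    by (rule integrable_mult_of_squares[OF _ _ i(1,3)]) measurable
  have "(\<integral>z. fst z * snd z \<partial>(std_normal \<Otimes>\<^sub>M std_normal)) = (\<integral>u. \<integral>w. u * w \<partial>std_normal \<partial>std_normal)"
    using std_normal_pair.integral_fst'[OF uw] by simp
  then have uw0: "(\<integral>z. fst z * snd z \<partial>(std_normal \<Otimes>\<^sub>M std_normal)) = 0"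
    by (simp add: std_normal_moments)
  have "(\<integral>z. fst z * snd z \<partial>corr_pair p) =
      (\<integral>z. p * (fst z * fst z) + sqrt (1 - p\<^sup>2) * (fst z * snd z) \<partial>(std_normal \<Otimes>\<^sub>M std_normal))"
    unfolding corr_pair_def by (subst integral_distr) (auto simp: case_prod_beta algebra_simps)
  also have "\<dots> = p"
    using i uw uw0 by simp
  finally show ?thesis .
qed

section \<open>Conditional laws by resampling the future noise\<close>

definition splice_at :: "nat \<Rightarrow> nat \<Rightarrow> (nat \<Rightarrow> 'a) \<Rightarrow> (nat \<Rightarrow> 'a) \<Rightarrow> nat \<Rightarrow> 'a" where
  "splice_at n t z z' = (\<lambda>i\<in>{..<n}. if i < t then z i else z' i)"

lemma measurable_splice_at [measurable]:
  "(\<lambda>(z, z'). splice_at n t z z') \<in> PiM {..<n} N \<Otimes>\<^sub>M PiM {..<n} N \<rightarrow>\<^sub>M PiM {..<n} N"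
  unfolding splice_at_def case_prod_beta
proof (rule measurable_restrict)
  fix i assume i: "i \<in> {..<n}"
  have "(\<lambda>x. fst x i) \<in> PiM {..<n} N \<Otimes>\<^sub>M PiM {..<n} N \<rightarrow>\<^sub>M N i"
    "(\<lambda>x. snd x i) \<in> PiM {..<n} N \<Otimes>\<^sub>M PiM {..<n} N \<rightarrow>\<^sub>M N i"
    using i by measurable
  then show "(\<lambda>x. if i < t then fst x i else snd x i) \<in> PiM {..<n} N \<Otimes>\<^sub>M PiM {..<n} N \<rightarrow>\<^sub>M N i"
    by (cases "i < t") simp_all
qed

lemma distr_splice:
  assumes N: "\<And>i. prob_space (N i)"
  shows "distr (PiM {..<n} N \<Otimes>\<^sub>M PiM {..<n} N) (PiM {..<n} N) (\<lambda>(z, z'). splice_at n t z z') = PiM {..<n} N"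
proof -
  interpret N: product_sigma_finite N using N by (rule product_sigma_finite_prob_space)
  interpret Z: prob_space "PiM {..<n} N" using N by (rule prob_space_PiM)
  let ?Z = "PiM {..<n} N"
  show ?thesis
  proof (rule N.PiM_eqI)
    fix A assume A: "\<And>i. i \<in> {..<n} \<Longrightarrow> A i \<in> sets (N i)"
    define A1 where "A1 i = (if i < t then A i else space (N i))" for i
    define A2 where "A2 i = (if i < t then space (N i) else A i)" for i
    have A12: "i \<in> {..<n} \<Longrightarrow> A1 i \<in> sets (N i)" "i \<in> {..<n} \<Longrightarrow> A2 i \<in> sets (N i)" for i
      using A by (auto simp: A1_def A2_def)
    have sub: "i < n \<Longrightarrow> x \<in> A i \<Longrightarrow> x \<in> space (N i)" for i x
      using A sets.sets_into_space by blast
    have "emeasure (distr (?Z \<Otimes>\<^sub>M ?Z) ?Z (\<lambda>(z, z'). splice_at n t z z')) (Pi\<^sub>E {..<n} A) =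
      emeasure (?Z \<Otimes>\<^sub>M ?Z) ((\<lambda>(z, z'). splice_at n t z z') -` Pi\<^sub>E {..<n} A \<inter> space (?Z \<Otimes>\<^sub>M ?Z))"
      using A by (intro emeasure_distr measurable_splice_at sets_PiM_I_finite) auto
    also have "(\<lambda>(z, z'). splice_at n t z z') -` Pi\<^sub>E {..<n} A \<inter> space (?Z \<Otimes>\<^sub>M ?Z) = Pi\<^sub>E {..<n} A1 \<times> Pi\<^sub>E {..<n} A2"
      using sub
      by (auto simp: splice_at_def space_pair_measure space_PiM PiE_iff A1_def A2_def split: if_splits)
        (metis lessThan_iff)
    also have "emeasure (?Z \<Otimes>\<^sub>M ?Z) \<dots> = emeasure ?Z (Pi\<^sub>E {..<n} A1) * emeasure ?Z (Pi\<^sub>E {..<n} A2)"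
      using A12 by (intro Z.emeasure_pair_measure_Times sets_PiM_I_finite) auto
    also have "emeasure ?Z (Pi\<^sub>E {..<n} A1) = (\<Prod>i<n. emeasure (N i) (A1 i))"
      using A12 by (intro N.emeasure_PiM) auto
    also have "emeasure ?Z (Pi\<^sub>E {..<n} A2) = (\<Prod>i<n. emeasure (N i) (A2 i))"
      using A12 by (intro N.emeasure_PiM) auto
    also have "(\<Prod>i<n. emeasure (N i) (A1 i)) * (\<Prod>i<n. emeasure (N i) (A2 i)) =
        (\<Prod>i<n. emeasure (N i) (A1 i) * emeasure (N i) (A2 i))"
      by (rule prod.distrib[symmetric])
    also have "\<dots> = (\<Prod>i<n. emeasure (N i) (A i))"
      using N by (intro prod.cong) (auto simp: A1_def A2_def prob_space.emeasure_space_1)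
    finally show "emeasure (distr (?Z \<Otimes>\<^sub>M ?Z) ?Z (\<lambda>(z, z'). splice_at n t z z')) (Pi\<^sub>E {..<n} A) =
      (\<Prod>i<n. emeasure (N i) (A i))" .
  qed simp_all
qed

text \<open>The conditional law of \<open>g\<close> given \<open>f\<close> for functions of independent noise: if \<open>f\<close> depends on the noise before \<open>t\<close>
  only, keep that noise and draw the rest afresh. This holds because splicing two independent copies of the
  noise at time \<open>t\<close> reproduces its law.\<close>

lemma regular_cond_law_splice:
  fixes N :: "nat \<Rightarrow> 'a measure" and n :: nat
  defines "Z \<equiv> PiM {..<n} N"
  assumes N: "\<And>i. prob_space (N i)"
    and h [measurable]: "h \<in> Z \<rightarrow>\<^sub>M \<Omega>" and f [measurable]: "f \<in> \<Omega> \<rightarrow>\<^sub>M E" and g [measurable]: "g \<in> \<Omega> \<rightarrow>\<^sub>M E'"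
    and K [measurable]: "K \<in> E \<rightarrow>\<^sub>M prob_algebra E'"
    and past: "\<And>z z'. f (h (splice_at n t z z')) = f (h z)"
    and law: "\<And>z. z \<in> space Z \<Longrightarrow> K (f (h z)) = distr Z E' (\<lambda>z'. g (h (splice_at n t z z')))"
  shows "regular_cond_law (distr Z \<Omega> h) E f E' g K"
  unfolding regular_cond_law_def
proof (intro conjI ballI K)
  interpret Z: prob_space Z unfolding Z_def using N by (rule prob_space_PiM)
  have Ks [measurable]: "K \<in> E \<rightarrow>\<^sub>M subprob_algebra E'" by (rule measurable_prob_algebraD) fact
  have spl [measurable]: "(\<lambda>(z, z'). splice_at n t z z') \<in> Z \<Otimes>\<^sub>M Z \<rightarrow>\<^sub>M Z"
    unfolding Z_def by measurable
  fix C D assume [measurable]: "C \<in> sets E" "D \<in> sets E'"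
  let ?F = "\<lambda>z. indicator C (f (h z)) * indicator D (g (h z)) :: ennreal"
  have "emeasure (distr Z \<Omega> h) {w \<in> space (distr Z \<Omega> h). f w \<in> C \<and> g w \<in> D} =
     (\<integral>\<^sup>+w. indicator {w \<in> space (distr Z \<Omega> h). f w \<in> C \<and> g w \<in> D} w \<partial>distr Z \<Omega> h)"
    by (rule nn_integral_indicator[symmetric]) measurable
  also have "\<dots> = (\<integral>\<^sup>+w. indicator C (f w) * indicator D (g w) \<partial>distr Z \<Omega> h)"
    by (intro nn_integral_cong) (auto simp: indicator_def)
  also have "\<dots> = (\<integral>\<^sup>+z. ?F z \<partial>Z)" by (rule nn_integral_distr) measurable
  also have "\<dots> = (\<integral>\<^sup>+z. ?F z \<partial>distr (Z \<Otimes>\<^sub>M Z) Z (\<lambda>(z, z'). splice_at n t z z'))"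
    unfolding Z_def by (simp only: distr_splice[OF N])
  also have "\<dots> = (\<integral>\<^sup>+x. ?F ((\<lambda>(z, z'). splice_at n t z z') x) \<partial>(Z \<Otimes>\<^sub>M Z))"
    by (rule nn_integral_distr) measurable
  also have "\<dots> = (\<integral>\<^sup>+z. \<integral>\<^sup>+z'. ?F (splice_at n t z z') \<partial>Z \<partial>Z)"
  proof -
    have "?F \<in> borel_measurable Z" by measurable
    from Z.nn_integral_fst[OF measurable_compose[OF spl this]] show ?thesis by simp
  qed
  also have "\<dots> = (\<integral>\<^sup>+z. indicator C (f (h z)) * emeasure (K (f (h z))) D \<partial>Z)"
  proof (intro nn_integral_cong)
    fix z assume z: "z \<in> space Z"
    then have [measurable]: "(\<lambda>z'. splice_at n t z z') \<in> Z \<rightarrow>\<^sub>M Z"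
      using measurable_compose[OF measurable_Pair1'[OF z] spl] by simp
    have "(\<integral>\<^sup>+z'. ?F (splice_at n t z z') \<partial>Z) = (\<integral>\<^sup>+z'. indicator C (f (h z)) * indicator D (g (h (splice_at n t z z'))) \<partial>Z)"
      by (simp only: past)
    also have "\<dots> = indicator C (f (h z)) * (\<integral>\<^sup>+z'. indicator D (g (h (splice_at n t z z'))) \<partial>Z)"
      by (rule nn_integral_cmult) measurable
    also have "(\<integral>\<^sup>+z'. indicator D (g (h (splice_at n t z z'))) \<partial>Z) = (\<integral>\<^sup>+x. indicator D x \<partial>K (f (h z)))"
      unfolding law[OF z] by (rule nn_integral_distr[symmetric]) measurable
    also have "\<dots> = emeasure (K (f (h z))) D"
      by (rule nn_integral_indicator) (simp add: law[OF z])
    finally show "(\<integral>\<^sup>+z'. ?F (splice_at n t z z') \<partial>Z) = indicator C (f (h z)) * emeasure (K (f (h z))) D" .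
  qed
  also have "\<dots> = (\<integral>\<^sup>+w. indicator C (f w) * emeasure (K (f w)) D \<partial>distr Z \<Omega> h)"
    by (rule nn_integral_distr[symmetric]) measurable
  finally show "emeasure (distr Z \<Omega> h) {w \<in> space (distr Z \<Omega> h). f w \<in> C \<and> g w \<in> D} =
    (\<integral>\<^sup>+w. indicator C (f w) * emeasure (K (f w)) D \<partial>distr Z \<Omega> h)" .
qed

text \<open>The path from time \<open>t\<close> on, driven by the noise reconstructed from an observed past \<open>x\<close> and by the fresh
  noise \<open>u\<close>. Only the values of \<open>x\<close> before \<open>t\<close> and those of \<open>u\<close> from \<open>t\<close> on enter.\<close>

definition continuation :: "nat \<Rightarrow> nat \<Rightarrow> (nat \<Rightarrow> real) \<Rightarrow> (nat \<Rightarrow> nat \<Rightarrow> real) \<Rightarrow> (nat \<Rightarrow> real) \<Rightarrow> (nat \<Rightarrow> real) \<Rightarrow> nat \<Rightarrow> real" where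
  "continuation T t a L x u = future T t (tri_map T a L (splice_at T t (tri_inv a L x) u))"

lemma measurable_continuation:
  assumes "t \<le> T"
  shows "(\<lambda>(x, u). continuation T t a L x u) \<in> path_space {..<t} \<Otimes>\<^sub>M path_space {..<T} \<rightarrow>\<^sub>M path_space {t..<T}"
proof -
  have "(\<lambda>z. splice_at T t (tri_inv a L (fst z)) (snd z)) \<in> path_space {..<t} \<Otimes>\<^sub>M path_space {..<T} \<rightarrow>\<^sub>M path_space {..<T}"
    unfolding splice_at_def
  proof (rule measurable_restrict)
    fix i assume i: "i \<in> {..<T}"
    show "(\<lambda>z. if i < t then tri_inv a L (fst z) i else snd z i)
      \<in> path_space {..<t} \<Otimes>\<^sub>M path_space {..<T} \<rightarrow>\<^sub>M borel"
    proof (cases "i < t")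
      case True
      then have "(\<lambda>x. tri_inv a L x i) \<in> borel_measurable (path_space {..<t})"
        by (intro measurable_tri_inv) auto
      from measurable_compose[OF measurable_fst this] show ?thesis using True by simp
    next
      case False
      have "(\<lambda>z. snd z i) \<in> path_space {..<t} \<Otimes>\<^sub>M path_space {..<T} \<rightarrow>\<^sub>M borel"
        using i by measurable
      then show ?thesis using False by simp
    qed
  qed
  from measurable_compose[OF measurable_compose[OF this measurable_tri_map] measurable_future]
  show ?thesis by (simp add: continuation_def case_prod_beta)
qed

lemma continuation_past_tri_map:
  assumes "t \<le> T" "\<And>i. i < T \<Longrightarrow> 0 < L i i"
  shows "continuation T t a L (past t (tri_map T a L u)) u' = future T t (tri_map T a L (splice_at T t u u'))"
proof -
  have "tri_inv a L (past t (tri_map T a L u)) i = u i" if "i < t" for i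
  proof -
    have "tri_inv a L (past t (tri_map T a L u)) i = tri_inv a L (tri_map T a L u) i"
      using that by (intro tri_inv_cong) (auto simp: past_def)
    also have "\<dots> = u i"
      using that assms by (intro tri_inv_tri_map) (auto simp: less_imp_neq[symmetric])
    finally show ?thesis .
  qed
  then have "splice_at T t (tri_inv a L (past t (tri_map T a L u))) u' = splice_at T t u u'"
    by (auto simp: splice_at_def)
  then show ?thesis by (simp add: continuation_def)
qed

lemma past_tri_map_splice:
  assumes "t \<le> T"
  shows "past t (tri_map T a L (splice_at T t u u')) = past t (tri_map T a L u)"
  using assms by (intro past_tri_map_cong) (auto simp: splice_at_def)

lemma path_cond_law_tri_gaussian:
  assumes t: "t \<le> T" and pos: "\<And>i. i < T \<Longrightarrow> 0 < L i i"
  shows "path_cond_law T t (tri_gaussian T a L)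
    (\<lambda>x. distr (white_noise T) (path_space {t..<T}) (continuation T t a L x))"
  unfolding path_cond_law_def tri_gaussian_def white_noise_def
proof (rule regular_cond_law_splice)
  show "tri_map T a L \<in> PiM {..<T} (\<lambda>_. std_normal) \<rightarrow>\<^sub>M path_space {..<T}"
    using measurable_tri_map[of T a L] by (simp add: white_noise_def[symmetric] measurable_cong_sets[OF sets_white_noise refl])
  have w: "white_noise T \<in> space (prob_algebra (path_space {..<T}))"
    by (simp add: space_prob_algebra)
  show "(\<lambda>x. distr (PiM {..<T} (\<lambda>_. std_normal)) (path_space {t..<T}) (continuation T t a L x)) \<in>
    path_space {..<t} \<rightarrow>\<^sub>M prob_algebra (path_space {t..<T})"
    unfolding white_noise_def[symmetric]
    by (rule measurable_distr_prob_space2[OF measurable_const[OF w] measurable_continuation[OF t]])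
  fix z :: "nat \<Rightarrow> real"
  show "distr (PiM {..<T} (\<lambda>_. std_normal)) (path_space {t..<T}) (continuation T t a L (past t (tri_map T a L z))) =
      distr (PiM {..<T} (\<lambda>_. std_normal)) (path_space {t..<T}) (\<lambda>z'. future T t (tri_map T a L (splice_at T t z z')))"
    using t pos by (intro arg_cong[where f = "distr _ _"] ext continuation_past_tri_map)
  show "past t (tri_map T a L (splice_at T t z z')) = past t (tri_map T a L z)" for z'
    using t by (rule past_tri_map_splice)
qed (use t in \<open>auto intro: measurable_past measurable_future\<close>)

section \<open>The coupling with prescribed noise correlations\<close>

definition coords :: "nat \<Rightarrow> ('a \<Rightarrow> 'b) \<Rightarrow> (nat \<Rightarrow> 'a) \<Rightarrow> nat \<Rightarrow> 'b" where
  "coords n f z = (\<lambda>i\<in>{..<n}. f (z i))"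

lemma measurable_coords:
  assumes "\<And>i. i < n \<Longrightarrow> f \<in> N i \<rightarrow>\<^sub>M N' i"
  shows "coords n f \<in> PiM {..<n} N \<rightarrow>\<^sub>M PiM {..<n} N'"
  unfolding coords_def[abs_def]
  using assms by (intro measurable_restrict) (auto intro!: measurable_compose[OF measurable_component_singleton])

lemma tri_map_coords_splice:
  "tri_map n a L (coords n f (splice_at n t z z')) = tri_map n a L (splice_at n t (coords n f z) (coords n f z'))"
  by (intro tri_map_cong) (auto simp: coords_def splice_at_def)

text \<open>The candidate for the optimal coupling: the noise pairs are independent in time and have correlation \<open>p i\<close> at
  time \<open>i\<close>.\<close>

locale noise_coupling =
  fixes T :: nat and a b :: "nat \<Rightarrow> real" and L M :: "nat \<Rightarrow> nat \<Rightarrow> real" and p :: "nat \<Rightarrow> real"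
  assumes L_pos: "\<And>i. i < T \<Longrightarrow> 0 < L i i" and M_pos: "\<And>i. i < T \<Longrightarrow> 0 < M i i"
    and p_le: "\<And>i. \<bar>p i\<bar> \<le> 1"
begin

definition Z :: "(nat \<Rightarrow> real \<times> real) measure" where
  "Z = PiM {..<T} (\<lambda>i. corr_pair (p i))"

lemma sets_Z [measurable_cong]: "sets Z = sets (PiM {..<T} (\<lambda>_. borel \<Otimes>\<^sub>M borel))"
  unfolding Z_def by (intro sets_PiM_cong) auto

lemma prob_space_Z: "prob_space Z"
  unfolding Z_def by (intro prob_space_PiM) simp

lemma measurable_coords_fst [measurable]: "coords T fst \<in> Z \<rightarrow>\<^sub>M path_space {..<T}"
  unfolding measurable_cong_sets[OF sets_Z refl] by (intro measurable_coords) measurable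

lemma measurable_coords_snd [measurable]: "coords T snd \<in> Z \<rightarrow>\<^sub>M path_space {..<T}"
  unfolding measurable_cong_sets[OF sets_Z refl] by (intro measurable_coords) measurable

lemma distr_Z_fst: "distr Z (path_space {..<T}) (coords T fst) = white_noise T"
proof -
  have "distr Z (path_space {..<T}) (coords T fst) = PiM {..<T} (\<lambda>i. distr (corr_pair (p i)) borel fst)"
    unfolding Z_def coords_def
    by (intro distr_PiM_componentwise product_sigma_finite_prob_space) (auto simp: distr_corr_pair_fst)
  then show ?thesis by (simp add: distr_corr_pair_fst white_noise_def)
qed

lemma distr_Z_snd: "distr Z (path_space {..<T}) (coords T snd) = white_noise T"
proof -
  have "distr Z (path_space {..<T}) (coords T snd) = PiM {..<T} (\<lambda>i. distr (corr_pair (p i)) borel snd)"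
    unfolding Z_def coords_def
    by (intro distr_PiM_componentwise product_sigma_finite_prob_space) (auto simp: distr_corr_pair_snd[OF p_le])
  then show ?thesis by (simp add: distr_corr_pair_snd[OF p_le] white_noise_def)
qed

definition paths :: "(nat \<Rightarrow> real \<times> real) \<Rightarrow> (nat \<Rightarrow> real) \<times> (nat \<Rightarrow> real)" where
  "paths z = (tri_map T a L (coords T fst z), tri_map T b M (coords T snd z))"

lemma measurable_paths [measurable]: "paths \<in> Z \<rightarrow>\<^sub>M path_space {..<T} \<Otimes>\<^sub>M path_space {..<T}"
  unfolding paths_def[abs_def] by measurable

definition \<kappa> :: "((nat \<Rightarrow> real) \<times> (nat \<Rightarrow> real)) measure" where
  "\<kappa> = distr Z (path_space {..<T} \<Otimes>\<^sub>M path_space {..<T}) paths"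

lemma coupling: "\<kappa> \<in> couplings (tri_gaussian T a L) (tri_gaussian T b M)"
  unfolding couplings_def
proof (intro CollectI conjI)
  show "prob_space \<kappa>"
    unfolding \<kappa>_def by (intro prob_space.prob_space_distr prob_space_Z) measurable
  show "sets \<kappa> = sets (tri_gaussian T a L \<Otimes>\<^sub>M tri_gaussian T b M)"
    unfolding \<kappa>_def sets_distr by (intro sets_pair_measure_cong) simp_all
  have "distr \<kappa> (tri_gaussian T a L) fst = distr Z (path_space {..<T}) (\<lambda>z. tri_map T a L (coords T fst z))"
    unfolding \<kappa>_def by (subst distr_distr) (auto simp: comp_def paths_def intro!: distr_cong)
  also have "\<dots> = distr (distr Z (path_space {..<T}) (coords T fst)) (path_space {..<T}) (tri_map T a L)"
    by (subst distr_distr) (auto simp: comp_def)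
  finally show "distr \<kappa> (tri_gaussian T a L) fst = tri_gaussian T a L"
    by (simp add: distr_Z_fst tri_gaussian_def)
  have "distr \<kappa> (tri_gaussian T b M) snd = distr Z (path_space {..<T}) (\<lambda>z. tri_map T b M (coords T snd z))"
    unfolding \<kappa>_def by (subst distr_distr) (auto simp: comp_def paths_def intro!: distr_cong)
  also have "\<dots> = distr (distr Z (path_space {..<T}) (coords T snd)) (path_space {..<T}) (tri_map T b M)"
    by (subst distr_distr) (auto simp: comp_def)
  finally show "distr \<kappa> (tri_gaussian T b M) snd = tri_gaussian T b M"
    by (simp add: distr_Z_snd tri_gaussian_def)
qed

sublocale gaussian_coupling T a b L M \<kappa>
  using L_pos M_pos coupling by unfold_locales

text \<open>Both futures are continued with one common sample of the correlated noise. Each marginal of the kernel is then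
  the conditional law of the corresponding path, because each marginal of the noise is white.\<close>

definition K :: "nat \<Rightarrow> (nat \<Rightarrow> real) \<times> (nat \<Rightarrow> real) \<Rightarrow> ((nat \<Rightarrow> real) \<times> (nat \<Rightarrow> real)) measure" where
  "K t = (\<lambda>(x, y). distr Z (path_space {t..<T} \<Otimes>\<^sub>M path_space {t..<T})
     (\<lambda>z. (continuation T t a L x (coords T fst z), continuation T t b M y (coords T snd z))))"

lemma pair_cond_law_K:
  assumes t: "t \<le> T"
  shows "pair_cond_law T t \<kappa> (K t)"
  unfolding pair_cond_law_def \<kappa>_def
proof (rule regular_cond_law_splice[where N = "\<lambda>i. corr_pair (p i)" and n = T, folded Z_def])
  note [measurable] = measurable_past[OF t] measurable_future[of T t] measurable_continuation[OF t]
  show "paths \<in> Z \<rightarrow>\<^sub>M path_space {..<T} \<Otimes>\<^sub>M path_space {..<T}" by measurable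
  show "map_prod (past t) (past t) \<in> path_space {..<T} \<Otimes>\<^sub>M path_space {..<T} \<rightarrow>\<^sub>M path_space {..<t} \<Otimes>\<^sub>M path_space {..<t}"
    "map_prod (future T t) (future T t) \<in> path_space {..<T} \<Otimes>\<^sub>M path_space {..<T} \<rightarrow>\<^sub>M path_space {t..<T} \<Otimes>\<^sub>M path_space {t..<T}"
    unfolding map_prod_def by measurable
  have Zs: "Z \<in> space (prob_algebra Z)"
    by (simp add: space_prob_algebra prob_space_Z)
  show "K t \<in> path_space {..<t} \<Otimes>\<^sub>M path_space {..<t} \<rightarrow>\<^sub>M prob_algebra (path_space {t..<T} \<Otimes>\<^sub>M path_space {t..<T})"
    unfolding K_def case_prod_beta
  proof (rule measurable_distr_prob_space2[OF measurable_const[OF Zs]])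
    have 1: "(\<lambda>w. (fst (fst w), coords T fst (snd w))) \<in> (path_space {..<t} \<Otimes>\<^sub>M path_space {..<t}) \<Otimes>\<^sub>M Z
        \<rightarrow>\<^sub>M path_space {..<t} \<Otimes>\<^sub>M path_space {..<T}" by measurable
    have 2: "(\<lambda>w. (snd (fst w), coords T snd (snd w))) \<in> (path_space {..<t} \<Otimes>\<^sub>M path_space {..<t}) \<Otimes>\<^sub>M Z
        \<rightarrow>\<^sub>M path_space {..<t} \<Otimes>\<^sub>M path_space {..<T}" by measurable
    show "(\<lambda>(x, z). (continuation T t a L (fst x) (coords T fst z), continuation T t b M (snd x) (coords T snd z)))
      \<in> (path_space {..<t} \<Otimes>\<^sub>M path_space {..<t}) \<Otimes>\<^sub>M Z \<rightarrow>\<^sub>M path_space {t..<T} \<Otimes>\<^sub>M path_space {t..<T}"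
      using measurable_Pair[OF measurable_compose[OF 1 measurable_continuation[OF t, of a L]]
          measurable_compose[OF 2 measurable_continuation[OF t, of b M]]]
      by (simp add: case_prod_beta)
  qed
  fix z :: "nat \<Rightarrow> real \<times> real"
  show "map_prod (past t) (past t) (paths (splice_at T t z z')) = map_prod (past t) (past t) (paths z)" for z'
    using t by (simp add: paths_def tri_map_coords_splice past_tri_map_splice)
  show "K t (map_prod (past t) (past t) (paths z)) = distr Z (path_space {t..<T} \<Otimes>\<^sub>M path_space {t..<T})
      (\<lambda>z'. map_prod (future T t) (future T t) (paths (splice_at T t z z')))"
    using t L_pos M_pos by (simp add: K_def paths_def tri_map_coords_splice continuation_past_tri_map)
qed simp

lemma K_coupling:
  assumes t: "t \<le> T" and x: "x \<in> space (path_space {..<t})" and y: "y \<in> space (path_space {..<t})"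
  shows "K t (x, y) \<in> couplings (distr (white_noise T) (path_space {t..<T}) (continuation T t a L x))
    (distr (white_noise T) (path_space {t..<T}) (continuation T t b M y))"
proof -
  have cx [measurable]: "continuation T t a L x \<in> path_space {..<T} \<rightarrow>\<^sub>M path_space {t..<T}"
    using measurable_compose[OF measurable_Pair1'[OF x] measurable_continuation[OF t, of a L]] by simp
  have cy [measurable]: "continuation T t b M y \<in> path_space {..<T} \<rightarrow>\<^sub>M path_space {t..<T}"
    using measurable_compose[OF measurable_Pair1'[OF y] measurable_continuation[OF t, of b M]] by simp
  let ?K1 = "distr (white_noise T) (path_space {t..<T}) (continuation T t a L x)"
  let ?K2 = "distr (white_noise T) (path_space {t..<T}) (continuation T t b M y)"
  show ?thesis
    unfolding couplings_def
  proof (intro CollectI conjI)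
    show "prob_space (K t (x, y))"
      unfolding K_def prod.case by (intro prob_space.prob_space_distr prob_space_Z) measurable
    show "sets (K t (x, y)) = sets (?K1 \<Otimes>\<^sub>M ?K2)"
      unfolding K_def prod.case sets_distr by (intro sets_pair_measure_cong) simp_all
    have "distr (K t (x, y)) ?K1 fst = distr Z (path_space {t..<T}) (\<lambda>z. continuation T t a L x (coords T fst z))"
      unfolding K_def prod.case by (subst distr_distr) (auto simp: comp_def intro!: distr_cong)
    also have "\<dots> = distr (distr Z (path_space {..<T}) (coords T fst)) (path_space {t..<T}) (continuation T t a L x)"
      by (subst distr_distr) (auto simp: comp_def)
    finally show "distr (K t (x, y)) ?K1 fst = ?K1" by (simp only: distr_Z_fst)
    have "distr (K t (x, y)) ?K2 snd = distr Z (path_space {t..<T}) (\<lambda>z. continuation T t b M y (coords T snd z))"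
      unfolding K_def prod.case by (subst distr_distr) (auto simp: comp_def intro!: distr_cong)
    also have "\<dots> = distr (distr Z (path_space {..<T}) (coords T snd)) (path_space {t..<T}) (continuation T t b M y)"
      by (subst distr_distr) (auto simp: comp_def)
    finally show "distr (K t (x, y)) ?K2 snd = ?K2" by (simp only: distr_Z_snd)
  qed
qed

lemma bicausal: "\<kappa> \<in> bicausal_couplings T (tri_gaussian T a L) (tri_gaussian T b M)"
  unfolding bicausal_couplings_def
proof (intro CollectI conjI coupling ballI exI)
  fix t assume "t \<in> {1..<T}"
  then have t: "t \<le> T" by simp
  show "path_cond_law T t (tri_gaussian T a L) (\<lambda>x. distr (white_noise T) (path_space {t..<T}) (continuation T t a L x))"
    using t L_pos by (rule path_cond_law_tri_gaussian)
  show "path_cond_law T t (tri_gaussian T b M) (\<lambda>x. distr (white_noise T) (path_space {t..<T}) (continuation T t b M x))"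
    using t M_pos by (rule path_cond_law_tri_gaussian)
  show "pair_cond_law T t \<kappa> (K t)"
    using t by (rule pair_cond_law_K)
  show "AE (x, y) in \<kappa>. K t (past t x, past t y) \<in>
      couplings (distr (white_noise T) (path_space {t..<T}) (continuation T t a L (past t x)))
        (distr (white_noise T) (path_space {t..<T}) (continuation T t b M (past t y)))"
  proof (rule AE_I2)
    fix w assume w: "w \<in> space \<kappa>"
    obtain x y where xy: "w = (x, y)" by force
    then have "x \<in> space (path_space {..<T})" "y \<in> space (path_space {..<T})"
      using w by (auto simp: space_coupling)
    then show "case w of (x, y) \<Rightarrow> K t (past t x, past t y) \<in>
      couplings (distr (white_noise T) (path_space {t..<T}) (continuation T t a L (past t x)))
        (distr (white_noise T) (path_space {t..<T}) (continuation T t b M (past t y)))"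
      unfolding xy prod.case by (intro K_coupling t measurable_space[OF measurable_past[OF t]])
  qed
qed

lemma noise_paths:
  assumes "t < T"
  shows "U t (paths z) = fst (z t)" "V t (paths z) = snd (z t)"
  using assms L_pos M_pos
  by (auto simp: U.noise_def V.noise_def paths_def tri_inv_tri_map less_imp_neq[symmetric] coords_def)

lemma corr_eq:
  assumes t: "t < T"
  shows "corr t = p t"
proof -
  have [measurable]: "U t \<in> borel_measurable \<kappa>" "V t \<in> borel_measurable \<kappa>"
    using t by (auto intro: U.measurable_noise V.measurable_noise)
  have [measurable]: "(\<lambda>w. U t w * V t w) \<in> borel_measurable (path_space {..<T} \<Otimes>\<^sub>M path_space {..<T})"
    unfolding measurable_cong_sets[OF sets_coupling[symmetric] refl] by measurable
  have "corr t = (\<integral>z. U t (paths z) * V t (paths z) \<partial>Z)"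
    unfolding corr_def by (subst (1) \<kappa>_def, subst integral_distr) auto
  also have "\<dots> = (\<integral>z. fst (z t) * snd (z t) \<partial>Z)"
    by (simp add: noise_paths[OF t])
  also have "\<dots> = (\<integral>x. fst x * snd x \<partial>distr Z (corr_pair (p t)) (\<lambda>z. z t))"
    unfolding Z_def using t by (subst integral_distr) auto
  also have "distr Z (corr_pair (p t)) (\<lambda>z. z t) = corr_pair (p t)"
    unfolding Z_def using t by (intro distr_PiM_component) auto
  finally show ?thesis by (simp add: corr_pair_covariance)
qed

end

section \<open>The density of the coupling\<close>

text \<open>A sequence of independent pairs is a pair of independent sequences. The converse operation, zipping two
  sequences, is checked on boxes of arbitrary planar sets, where Fubini's theorem and the product formula
  apply; unzipping then inverts it.\<close>

lemma distr_white_noise_pair: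
  "distr (PiM {..<n} (\<lambda>_. std_normal \<Otimes>\<^sub>M std_normal)) (path_space {..<n} \<Otimes>\<^sub>M path_space {..<n})
    (\<lambda>z. (coords n fst z, coords n snd z)) = white_noise n \<Otimes>\<^sub>M white_noise n"
proof -
  let ?N = "\<lambda>_::nat. std_normal \<Otimes>\<^sub>M std_normal"
  let ?W = "white_noise n \<Otimes>\<^sub>M white_noise n"
  let ?PP = "path_space {..<n} \<Otimes>\<^sub>M path_space {..<n}"
  interpret N: product_sigma_finite ?N
    by (intro product_sigma_finite_prob_space std_normal_pair.prob_space_axioms)
  interpret S: product_sigma_finite "\<lambda>_::nat. std_normal"
    by (intro product_sigma_finite_prob_space prob_space_std_normal)
  interpret W: prob_space "white_noise n" by simp
  define pair where "pair w = (\<lambda>i\<in>{..<n}. (fst w i, snd w i))" for w :: "(nat \<Rightarrow> real) \<times> (nat \<Rightarrow> real)"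
  define unpair where "unpair z = (coords n fst z, coords n snd z)" for z :: "nat \<Rightarrow> real \<times> real"
  have setsW: "sets ?W = sets ?PP" by (intro sets_pair_measure_cong) simp_all
  have setsN: "sets (PiM {..<n} ?N) = sets (PiM {..<n} (\<lambda>_. borel \<Otimes>\<^sub>M borel))"
    by (intro sets_PiM_cong) (auto simp: sets_std_normal_pair)
  have pair [measurable]: "pair \<in> ?W \<rightarrow>\<^sub>M PiM {..<n} ?N"
    unfolding pair_def[abs_def] measurable_cong_sets[OF setsW setsN]
    by (intro measurable_restrict) measurable
  have unpair [measurable]: "unpair \<in> PiM {..<n} ?N \<rightarrow>\<^sub>M ?PP"
    unfolding unpair_def[abs_def] measurable_cong_sets[OF setsN refl]
    by (intro measurable_Pair measurable_coords) measurable
  have "distr ?W (PiM {..<n} ?N) pair = PiM {..<n} ?N"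
  proof (rule N.PiM_eqI)
    fix A assume A: "\<And>i. i \<in> {..<n} \<Longrightarrow> A i \<in> sets (std_normal \<Otimes>\<^sub>M std_normal)"
    let ?X = "pair -` Pi\<^sub>E {..<n} A \<inter> space ?W"
    have box: "Pi\<^sub>E {..<n} A \<in> sets (PiM {..<n} ?N)"
      using A by (intro sets_PiM_I_finite) auto
    have X: "?X \<in> sets ?W" using pair box by (rule measurable_sets)
    have "emeasure (distr ?W (PiM {..<n} ?N) pair) (Pi\<^sub>E {..<n} A) = emeasure ?W ?X"
      using pair box by (rule emeasure_distr)
    also have "\<dots> = (\<integral>\<^sup>+u. emeasure (white_noise n) (Pair u -` ?X) \<partial>white_noise n)"
      by (rule W.emeasure_pair_measure_alt[OF X])
    also have "\<dots> = (\<integral>\<^sup>+u. (\<Prod>i<n. emeasure std_normal (Pair (u i) -` A i)) \<partial>white_noise n)"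
    proof (intro nn_integral_cong)
      fix u assume u: "u \<in> space (white_noise n)"
      have "Pair u -` ?X = Pi\<^sub>E {..<n} (\<lambda>i. Pair (u i) -` A i)"
        using u by (auto simp: pair_def space_pair_measure space_white_noise space_PiM PiE_iff)
      also have "emeasure (white_noise n) \<dots> = (\<Prod>i<n. emeasure std_normal (Pair (u i) -` A i))"
        unfolding white_noise_def using A by (intro S.emeasure_PiM sets_Pair1) auto
      finally show "emeasure (white_noise n) (Pair u -` ?X) = (\<Prod>i<n. emeasure std_normal (Pair (u i) -` A i))" .
    qed
    also have "\<dots> = (\<Prod>i<n. \<integral>\<^sup>+c. emeasure std_normal (Pair c -` A i) \<partial>std_normal)"
      unfolding white_noise_def using A
      by (intro S.product_nn_integral_prod std_normal.measurable_emeasure_Pair) auto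
    also have "\<dots> = (\<Prod>i<n. emeasure (std_normal \<Otimes>\<^sub>M std_normal) (A i))"
      using A by (intro prod.cong refl std_normal.emeasure_pair_measure_alt[symmetric]) auto
    finally show "emeasure (distr ?W (PiM {..<n} ?N) pair) (Pi\<^sub>E {..<n} A) =
      (\<Prod>i<n. emeasure (std_normal \<Otimes>\<^sub>M std_normal) (A i))" .
  qed simp_all
  then have "distr (PiM {..<n} ?N) ?PP unpair = distr (distr ?W (PiM {..<n} ?N) pair) ?PP unpair"
    by simp
  also have "\<dots> = distr ?W ?PP (unpair \<circ> pair)"
    by (rule distr_distr[OF unpair pair])
  also have "\<dots> = distr ?W ?W (\<lambda>w. w)"
  proof (rule distr_cong)
    fix w assume w: "w \<in> space ?W"
    obtain u v where uv: "w = (u, v)" by force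
    have "u \<in> extensional {..<n}" "v \<in> extensional {..<n}"
      using w by (auto simp: uv space_pair_measure space_white_noise space_PiM PiE_iff)
    then have "restrict u {..<n} = u" "restrict v {..<n} = v"
      by (simp_all add: extensional_restrict)
    moreover have "coords n fst (pair w) = restrict u {..<n}" "coords n snd (pair w) = restrict v {..<n}"
      by (auto simp: coords_def pair_def uv)
    ultimately show "(unpair \<circ> pair) w = w"
      by (simp add: unpair_def uv)
  qed (simp_all add: setsW)
  finally show ?thesis by (simp add: unpair_def[abs_def])
qed

definition path_density :: "nat \<Rightarrow> (nat \<Rightarrow> real) \<Rightarrow> (nat \<Rightarrow> nat \<Rightarrow> real) \<Rightarrow> (nat \<Rightarrow> real) \<Rightarrow> (nat \<Rightarrow> nat \<Rightarrow> real)
    \<Rightarrow> (nat \<Rightarrow> real) \<Rightarrow> (nat \<Rightarrow> real) \<times> (nat \<Rightarrow> real) \<Rightarrow> real" where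
  "path_density T a L b M p w = (\<Prod>t<T. corr_density (p t) (tri_inv a L (fst w) t) (tri_inv b M (snd w) t))"

lemma measurable_path_density [measurable]:
  "path_density T a L b M p \<in> borel_measurable (path_space {..<T} \<Otimes>\<^sub>M path_space {..<T})"
  unfolding path_density_def[abs_def]
proof (intro borel_measurable_prod measurable_corr_density)
  fix t assume "t \<in> {..<T}"
  then have t: "{..t} \<subseteq> {..<T}" by auto
  show "(\<lambda>w. tri_inv a L (fst w) t) \<in> borel_measurable (path_space {..<T} \<Otimes>\<^sub>M path_space {..<T})"
    by (rule measurable_compose[OF measurable_fst measurable_tri_inv[OF t]])
  show "(\<lambda>w. tri_inv b M (snd w) t) \<in> borel_measurable (path_space {..<T} \<Otimes>\<^sub>M path_space {..<T})"
    by (rule measurable_compose[OF measurable_snd measurable_tri_inv[OF t]])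
qed

lemma path_density_pos: "(\<And>t. \<bar>p t\<bar> < 1) \<Longrightarrow> 0 < path_density T a L b M p w"
  unfolding path_density_def by (intro prod_pos) (simp add: corr_density_pos)

lemma (in noise_coupling) coupling_density:
  assumes p: "\<And>t. \<bar>p t\<bar> < 1"
  shows "\<kappa> = density (tri_gaussian T a L \<Otimes>\<^sub>M tri_gaussian T b M) (\<lambda>w. ennreal (path_density T a L b M p w))"
proof -
  let ?N = "\<lambda>_::nat. std_normal \<Otimes>\<^sub>M std_normal"
  let ?Z = "PiM {..<T} ?N"
  let ?PP = "path_space {..<T} \<Otimes>\<^sub>M path_space {..<T}"
  let ?Q = "\<lambda>w. ennreal (path_density T a L b M p w)"
  have setsN: "sets ?Z = sets (PiM {..<T} (\<lambda>_. borel \<Otimes>\<^sub>M borel))"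
    by (intro sets_PiM_cong) (auto simp: sets_std_normal_pair)
  have setsZ: "sets ?Z = sets Z" by (simp add: setsN sets_Z)
  have paths' [measurable]: "paths \<in> ?Z \<rightarrow>\<^sub>M ?PP"
    using measurable_paths by (simp only: measurable_cong_sets[OF setsZ refl])
  have "Z = PiM {..<T} (\<lambda>i. density (std_normal \<Otimes>\<^sub>M std_normal) (\<lambda>(u, v). ennreal (corr_density (p i) u v)))"
    unfolding Z_def by (simp only: corr_pair_eq_density[OF p])
  also have "\<dots> = density ?Z (\<lambda>z. \<Prod>i<T. case z i of (u, v) \<Rightarrow> ennreal (corr_density (p i) u v))"
  proof (rule PiM_density)
    show "product_sigma_finite ?N"
      by (intro product_sigma_finite_prob_space std_normal_pair.prob_space_axioms)
    show "product_sigma_finite (\<lambda>i. density (std_normal \<Otimes>\<^sub>M std_normal) (\<lambda>(u, v). ennreal (corr_density (p i) u v)))"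
      by (intro product_sigma_finite_prob_space) (simp add: corr_pair_eq_density[OF p, symmetric])
    show "(\<lambda>(u, v). ennreal (corr_density (p i) u v)) \<in> borel_measurable (std_normal \<Otimes>\<^sub>M std_normal)" for i
      by measurable
  qed simp
  also have "(\<lambda>z. \<Prod>i<T. case z i of (u, v) \<Rightarrow> ennreal (corr_density (p i) u v)) = (\<lambda>z. ?Q (paths z))"
  proof
    fix z
    have "path_density T a L b M p (paths z) = (\<Prod>t<T. corr_density (p t) (U t (paths z)) (V t (paths z)))"
      by (simp add: path_density_def U.noise_def V.noise_def)
    also have "\<dots> = (\<Prod>t<T. corr_density (p t) (fst (z t)) (snd (z t)))"
      by (intro prod.cong) (auto simp: noise_paths)
    finally show "(\<Prod>i<T. case z i of (u, v) \<Rightarrow> ennreal (corr_density (p i) u v)) = ?Q (paths z)"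
      using corr_density_pos[OF p] by (simp add: prod_ennreal less_imp_le case_prod_beta)
  qed
  finally have "\<kappa> = distr (density ?Z (\<lambda>z. ?Q (paths z))) ?PP paths"
    by (simp add: \<kappa>_def)
  also have "\<dots> = density (distr ?Z ?PP paths) ?Q"
    by (rule density_distr[symmetric]) measurable
  also have "distr ?Z ?PP paths = tri_gaussian T a L \<Otimes>\<^sub>M tri_gaussian T b M"
  proof -
    have setsW: "sets (white_noise T \<Otimes>\<^sub>M white_noise T) = sets ?PP" by (intro sets_pair_measure_cong) simp_all
    have m: "(\<lambda>(u, v). (tri_map T a L u, tri_map T b M v)) \<in> ?PP \<rightarrow>\<^sub>M ?PP"
      by measurable
    have c: "(\<lambda>z. (coords T fst z, coords T snd z)) \<in> ?Z \<rightarrow>\<^sub>M ?PP"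
      unfolding measurable_cong_sets[OF setsN refl] by (intro measurable_Pair measurable_coords) measurable
    have "distr ?Z ?PP paths = distr (distr ?Z ?PP (\<lambda>z. (coords T fst z, coords T snd z))) ?PP
        (\<lambda>(u, v). (tri_map T a L u, tri_map T b M v))"
      by (subst distr_distr[OF m c]) (auto simp: comp_def paths_def intro!: distr_cong)
    also have "\<dots> = distr (white_noise T \<Otimes>\<^sub>M white_noise T) ?PP (\<lambda>(u, v). (tri_map T a L u, tri_map T b M v))"
      by (simp only: distr_white_noise_pair)
    also have "\<dots> = tri_gaussian T a L \<Otimes>\<^sub>M tri_gaussian T b M"
      unfolding tri_gaussian_def
    proof (rule pair_measure_distr[symmetric])
      show "sigma_finite_measure (distr (white_noise T) (path_space {..<T}) (tri_map T b M))"
        using prob_space_imp_sigma_finite[OF prob_space_tri_gaussian[of T b M]] by (simp add: tri_gaussian_def)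
    qed measurable
    finally show ?thesis .
  qed
  finally show ?thesis .
qed

text \<open>Since the logarithm of the density is quadratic in the noise and the noises have unit variance, its expectation
  under any coupling depends on the coupling only through the correlations.\<close>

lemma (in gaussian_coupling) expectation_ln_path_density:
  assumes p: "\<And>t. \<bar>p t\<bar> < 1"
  shows "integrable \<pi> (\<lambda>w. ln (path_density T a L b M p w))"
    and "U.expectation (\<lambda>w. ln (path_density T a L b M p w)) =
      (\<Sum>t<T. - ln (1 - (p t)\<^sup>2) / 2 + (p t * corr t - (p t)\<^sup>2) / (1 - (p t)\<^sup>2))"
proof -
  define l where "l t w = - ln (1 - (p t)\<^sup>2) / 2 +
    (p t * (U t w * V t w) - (p t)\<^sup>2 / 2 * (U t w * U t w + V t w * V t w)) / (1 - (p t)\<^sup>2)" for t w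
  have ln: "ln (path_density T a L b M p w) = (\<Sum>t<T. l t w)" for w
    unfolding path_density_def using corr_density_pos[OF p, THEN less_imp_neq, symmetric]
    by (subst ln_prod) (auto simp: ln_corr_density[OF p] l_def U.noise_def V.noise_def corr_density_pos[OF p])
  have l: "integrable \<pi> (l t)"
    "U.expectation (l t) = - ln (1 - (p t)\<^sup>2) / 2 + (p t * corr t - (p t)\<^sup>2) / (1 - (p t)\<^sup>2)" if t: "t < T" for t
  proof -
    note int = integrable_cross[OF t t] U.noise_moments(3)[OF t t] V.noise_moments(3)[OF t t]
    show "integrable \<pi> (l t)"
      unfolding l_def[abs_def] using int by simp
    have "U.expectation (l t) = - ln (1 - (p t)\<^sup>2) / 2 + (p t * U.expectation (\<lambda>w. U t w * V t w) -
       (p t)\<^sup>2 / 2 * (U.expectation (\<lambda>w. U t w * U t w) + U.expectation (\<lambda>w. V t w * V t w))) / (1 - (p t)\<^sup>2)"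
      unfolding l_def[abs_def] using int U.prob_space by simp
    then show "U.expectation (l t) = - ln (1 - (p t)\<^sup>2) / 2 + (p t * corr t - (p t)\<^sup>2) / (1 - (p t)\<^sup>2)"
      using U.noise_moments(4)[OF t t] V.noise_moments(4)[OF t t] by (simp add: corr_def)
  qed
  show "integrable \<pi> (\<lambda>w. ln (path_density T a L b M p w))"
    unfolding ln using l by (intro Bochner_Integration.integrable_sum) auto
  show "U.expectation (\<lambda>w. ln (path_density T a L b M p w)) =
      (\<Sum>t<T. - ln (1 - (p t)\<^sup>2) / 2 + (p t * corr t - (p t)\<^sup>2) / (1 - (p t)\<^sup>2))"
    unfolding ln using l by (subst Bochner_Integration.integral_sum) auto
qed

section \<open>The optimal value\<close>

lemma f_reg_0: "f_reg 0 x = sgn x"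
  by (simp add: f_reg_def)

text \<open>The regularised sign is the root in \<open>(-1, 1)\<close> of the stationarity condition for the correlation: the
  derivative of \<open>- 2 x p - lam / 2 * ln (1 - p\<^sup>2)\<close> vanishes.\<close>

lemma f_reg_optimal:
  assumes "0 < lam"
  shows "\<bar>f_reg lam x\<bar> < 1" "lam * f_reg lam x / (1 - (f_reg lam x)\<^sup>2) = 2 * x"
proof -
  define k where "k = lam / (4 * \<bar>x\<bar>)"
  define s where "s = sqrt (k\<^sup>2 + 1)"
  have *: "\<bar>f_reg lam x\<bar> < 1 \<and> lam * f_reg lam x / (1 - (f_reg lam x)\<^sup>2) = 2 * x"
  proof (cases "x = 0")
    case True
    then show ?thesis by (simp add: f_reg_def)
  next
    case False
    then have k: "0 < k" "4 * \<bar>x\<bar> * k = lam" using assms by (auto simp: k_def)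
    have s2: "s\<^sup>2 = k\<^sup>2 + 1" by (simp add: s_def add_nonneg_nonneg)
    have "k < s" unfolding s_def by (rule real_less_rsqrt) simp
    moreover have "s < k + 1"
      unfolding s_def using k by (intro real_less_lsqrt) (auto simp: power2_eq_square algebra_simps)
    ultimately have q: "0 < s - k" "s - k < 1" by auto
    have f: "f_reg lam x = sgn x * (s - k)"
      using False by (simp add: f_reg_def s_def k_def)
    have "(f_reg lam x)\<^sup>2 = (s - k)\<^sup>2"
      using False by (simp add: f power_mult_distrib sgn_if)
    also have "1 - (s - k)\<^sup>2 = 2 * k * (s - k)"
      using s2 by (simp add: power2_eq_square algebra_simps)
    finally have f2: "1 - (f_reg lam x)\<^sup>2 = 2 * k * (s - k)"
      by (simp add: \<open>(f_reg lam x)\<^sup>2 = (s - k)\<^sup>2\<close> \<open>1 - (s - k)\<^sup>2 = 2 * k * (s - k)\<close>)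
    have "lam * f_reg lam x / (1 - (f_reg lam x)\<^sup>2) = (4 * \<bar>x\<bar> * k) * (sgn x * (s - k)) / (2 * k * (s - k))"
      unfolding f2 unfolding f k(2) ..
    also have "\<dots> = 2 * (\<bar>x\<bar> * sgn x)"
      using nonzero_mult_divide_mult_cancel_right[of "2 * k * (s - k)" "2 * (\<bar>x\<bar> * sgn x)" 1] k(1) q
      by (simp add: mult_ac)
    also have "\<bar>x\<bar> * sgn x = x" by (simp add: sgn_if abs_if)
    finally have "lam * f_reg lam x / (1 - (f_reg lam x)\<^sup>2) = 2 * x" .
    moreover have "\<bar>f_reg lam x\<bar> < 1" using q False by (simp add: f abs_mult)
    ultimately show ?thesis by blast
  qed
  then show "\<bar>f_reg lam x\<bar> < 1" "lam * f_reg lam x / (1 - (f_reg lam x)\<^sup>2) = 2 * x" by auto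
qed

lemma (in gaussian_coupling) transport_cost_eq:
  assumes cross_uncorrelated
    and "\<And>i j. i < j \<Longrightarrow> j < T \<Longrightarrow> L i j = 0" "\<And>i j. i < j \<Longrightarrow> j < T \<Longrightarrow> M i j = 0"
  shows "enn2ereal (\<integral>\<^sup>+(x, y). ennreal (sq_dist T x y) \<partial>\<pi>) = ereal
    ((\<Sum>i<T. (a i - b i)\<^sup>2) + (\<Sum>i<T. \<Sum>j<T. (L i j)\<^sup>2) + (\<Sum>i<T. \<Sum>j<T. (M i j)\<^sup>2)
      - 2 * (\<Sum>t<T. (\<Sum>i<T. M i t * L i t) * corr t))"
proof -
  have "(\<Sum>j\<le>i. (L i j)\<^sup>2 + (M i j)\<^sup>2 - 2 * (L i j * M i j * corr j)) =
    (\<Sum>j<T. (L i j)\<^sup>2 + (M i j)\<^sup>2 - 2 * (L i j * M i j * corr j))" if "i < T" for i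
    using that assms(2,3) by (intro sum.mono_neutral_left) auto
  moreover have "(\<Sum>i<T. \<Sum>j<T. L i j * M i j * corr j) = (\<Sum>t<T. (\<Sum>i<T. M i t * L i t) * corr t)"
    by (subst sum.swap) (simp add: sum_distrib_left sum_distrib_right mult_ac)
  ultimately show ?thesis
    unfolding transport_cost[OF assms(1)]
    by (simp add: sum.distrib sum_subtractf sum_distrib_left[symmetric])
qed

lemma (in gaussian_coupling) abs_corr_le:
  assumes t: "t < T"
  shows "\<bar>corr t\<bar> \<le> 1"
proof -
  note int = integrable_cross[OF t t] U.noise_moments(3)[OF t t] V.noise_moments(3)[OF t t]
  note var = U.noise_moments(4)[OF t t] V.noise_moments(4)[OF t t]
  have expand: "(x + y)\<^sup>2 = x * x + y * y + 2 * (x * y)" "(x - y)\<^sup>2 = x * x + y * y - 2 * (x * y)" for x y :: real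
    by (simp_all add: power2_eq_square algebra_simps)
  have "U.expectation (\<lambda>w. (U t w + V t w)\<^sup>2) = 2 + 2 * corr t"
    "U.expectation (\<lambda>w. (U t w - V t w)\<^sup>2) = 2 - 2 * corr t"
    unfolding expand using int var by (simp_all add: corr_def)
  moreover have "0 \<le> U.expectation (\<lambda>w. (U t w + V t w)\<^sup>2)" "0 \<le> U.expectation (\<lambda>w. (U t w - V t w)\<^sup>2)"
    by simp_all
  ultimately show ?thesis by linarith
qed

text \<open>The statement for Cholesky factors given as functions; \<open>N t\<close> is the diagonal entry of \<open>M\<^sup>T L\<close>.\<close>

theorem AW2_sq_tri_gaussian:
  fixes a b :: "nat \<Rightarrow> real" and L M :: "nat \<Rightarrow> nat \<Rightarrow> real"
  assumes lam: "0 \<le> lam"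
    and L: "\<And>i. i < T \<Longrightarrow> 0 < L i i" "\<And>i j. i < j \<Longrightarrow> j < T \<Longrightarrow> L i j = 0"
    and M: "\<And>i. i < T \<Longrightarrow> 0 < M i i" "\<And>i j. i < j \<Longrightarrow> j < T \<Longrightarrow> M i j = 0"
  defines "N \<equiv> \<lambda>t. \<Sum>i<T. M i t * L i t"
  shows "AW2_sq lam T (tri_gaussian T a L) (tri_gaussian T b M) = ereal
    ((\<Sum>i<T. (a i - b i)\<^sup>2) + (\<Sum>i<T. \<Sum>j<T. (L i j)\<^sup>2) + (\<Sum>i<T. \<Sum>j<T. (M i j)\<^sup>2)
      - 2 * (\<Sum>t<T. f_reg lam (N t) * N t) - lam / 2 * (\<Sum>t<T. ln (1 - (f_reg lam (N t))\<^sup>2)))"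
    (is "_ = ereal ?v")
proof -
  define C where "C = (\<Sum>i<T. (a i - b i)\<^sup>2) + (\<Sum>i<T. \<Sum>j<T. (L i j)\<^sup>2) + (\<Sum>i<T. \<Sum>j<T. (M i j)\<^sup>2)"
  define p where "p t = f_reg lam (N t)" for t
  let ?R = "tri_gaussian T a L \<Otimes>\<^sub>M tri_gaussian T b M"
  have p_le: "\<bar>p t\<bar> \<le> 1" for t
  proof (cases "lam = 0")
    case True
    then show ?thesis by (simp add: p_def f_reg_0 abs_sgn_eq)
  next
    case False
    then show ?thesis using f_reg_optimal(1)[of lam "N t"] lam by (simp add: p_def)
  qed
  interpret opt: noise_coupling T a b L M p
    using L M p_le by unfold_locales auto
  have setsR: "sets ?R = sets (path_space {..<T} \<Otimes>\<^sub>M path_space {..<T})"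
    by (intro sets_pair_measure_cong) simp_all
  have R: "prob_space ?R"
    by (intro prob_space_pair prob_space_tri_gaussian)
  have opt_cost: "enn2ereal (\<integral>\<^sup>+(x, y). ennreal (sq_dist T x y) \<partial>opt.\<kappa>) = ereal (C - 2 * (\<Sum>t<T. N t * p t))"
    using opt.transport_cost_eq[OF opt.bicausal_cross_uncorrelated[OF opt.bicausal] L(2) M(2)]
    by (simp add: C_def N_def opt.corr_eq)
  have cost: "gaussian_coupling T a b L M \<pi>"
    "enn2ereal (\<integral>\<^sup>+(x, y). ennreal (sq_dist T x y) \<partial>\<pi>) = ereal (C - 2 * (\<Sum>t<T. N t * gaussian_coupling.corr a b L M \<pi> t))"
    if "\<pi> \<in> bicausal_couplings T (tri_gaussian T a L) (tri_gaussian T b M)" for \<pi>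
  proof -
    show gc: "gaussian_coupling T a b L M \<pi>"
      using that L M by unfold_locales (auto simp: bicausal_couplings_def)
    show "enn2ereal (\<integral>\<^sup>+(x, y). ennreal (sq_dist T x y) \<partial>\<pi>) = ereal (C - 2 * (\<Sum>t<T. N t * gaussian_coupling.corr a b L M \<pi> t))"
      using gaussian_coupling.transport_cost_eq[OF gc gaussian_coupling.bicausal_cross_uncorrelated[OF gc that] L(2) M(2)]
      by (simp add: C_def N_def)
  qed
  let ?obj = "\<lambda>\<pi>. enn2ereal (\<integral>\<^sup>+(x, y). ennreal (sq_dist T x y) \<partial>\<pi>) + ereal lam * KL \<pi> ?R"
  have "ereal ?v \<le> ?obj \<pi>" if bc: "\<pi> \<in> bicausal_couplings T (tri_gaussian T a L) (tri_gaussian T b M)" for \<pi>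
  proof -
    interpret gaussian_coupling T a b L M \<pi> by (rule cost(1)[OF bc])
    show ?thesis
    proof (cases "lam = 0")
      case True
      have "N t * corr t \<le> p t * N t" if "t < T" for t
      proof -
        have "N t * corr t \<le> \<bar>N t\<bar> * \<bar>corr t\<bar>" by (metis abs_ge_self abs_mult)
        also have "\<dots> \<le> \<bar>N t\<bar>" using abs_corr_le[OF that] by (intro mult_left_le) auto
        also have "\<dots> = p t * N t" using True by (simp add: p_def f_reg_0 abs_sgn mult.commute)
        finally show ?thesis .
      qed
      then have "(\<Sum>t<T. N t * corr t) \<le> (\<Sum>t<T. p t * N t)" by (intro sum_mono) auto
      then show ?thesis
        using True unfolding cost(2)[OF bc] by (simp add: C_def p_def zero_ereal_def[symmetric])
    next
      case False
      then have lam_pos: "0 < lam" using lam by simp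
      have p: "\<bar>p t\<bar> < 1" for t using f_reg_optimal(1)[OF lam_pos] by (simp add: p_def)
      let ?q = "path_density T a L b M p"
      \<comment> \<open>The density integrates to one because it is the density of the coupling constructed above.\<close>
      have "(\<integral>\<^sup>+w. ennreal (?q w) \<partial>?R) = emeasure (density ?R (\<lambda>w. ennreal (?q w))) (space ?R)"
        by (subst emeasure_density[OF _ sets.top])
          (auto simp: measurable_cong_sets[OF setsR refl] intro!: nn_integral_cong)
      also have "\<dots> = 1"
        using opt.U.emeasure_space_1 by (simp add: opt.coupling_density[OF p])
      finally have q1: "(\<integral>\<^sup>+w. ennreal (?q w) \<partial>?R) \<le> 1" by simp
      have KL: "ereal (U.expectation (\<lambda>w. ln (?q w))) \<le> KL \<pi> ?R"
      proof (rule KL_ge_integral_ln[OF _ R _ _ _ q1])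
        show "sets \<pi> = sets ?R" by (simp add: sets_coupling setsR)
        show "?q \<in> borel_measurable ?R" by (simp add: measurable_cong_sets[OF setsR refl])
        show "0 < ?q w" for w using p by (rule path_density_pos)
        show "integrable \<pi> (\<lambda>w. ln (?q w))" using p by (rule expectation_ln_path_density)
      qed (rule U.prob_space_axioms)
      \<comment> \<open>Stationarity of \<open>p t\<close> removes the correlation of \<open>\<pi>\<close> from cost plus entropy bound.\<close>
      have t: "- 2 * (N t * corr t) + lam * (- ln (1 - (p t)\<^sup>2) / 2 + (p t * corr t - (p t)\<^sup>2) / (1 - (p t)\<^sup>2)) =
        - 2 * (p t * N t) - lam / 2 * ln (1 - (p t)\<^sup>2)" for t
      proof -
        have "lam * ((p t * corr t - (p t)\<^sup>2) / (1 - (p t)\<^sup>2)) = (lam * p t / (1 - (p t)\<^sup>2)) * (corr t - p t)"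
          by (simp add: power2_eq_square algebra_simps)
        also have "\<dots> = 2 * N t * (corr t - p t)"
          unfolding p_def by (simp only: f_reg_optimal(2)[OF lam_pos])
        finally have "lam * ((p t * corr t - (p t)\<^sup>2) / (1 - (p t)\<^sup>2)) = 2 * N t * (corr t - p t)" .
        then show ?thesis by (simp add: algebra_simps)
      qed
      have "?v = C + (\<Sum>t<T. - 2 * (p t * N t) - lam / 2 * ln (1 - (p t)\<^sup>2))"
        by (simp add: C_def p_def sum_subtractf sum_distrib_left sum_negf)
      also have "\<dots> = C - 2 * (\<Sum>t<T. N t * corr t) + lam * U.expectation (\<lambda>w. ln (?q w))"
        unfolding t[symmetric] expectation_ln_path_density(2)[OF p]
        by (simp add: sum.distrib sum_subtractf sum_distrib_left sum_negf right_diff_distrib)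
      finally have "ereal ?v = ereal (C - 2 * (\<Sum>t<T. N t * corr t)) + ereal lam * ereal (U.expectation (\<lambda>w. ln (?q w)))"
        by simp
      also have "\<dots> \<le> ?obj \<pi>"
        unfolding cost(2)[OF bc] using KL lam by (intro add_left_mono ereal_mult_left_mono) auto
      finally show ?thesis .
    qed
  qed
  moreover have "?obj opt.\<kappa> = ereal ?v"
  proof (cases "lam = 0")
    case True
    then show ?thesis
      unfolding opt_cost by (simp add: C_def p_def mult.commute zero_ereal_def[symmetric])
  next
    case False
    then have lam_pos: "0 < lam" using lam by simp
    have p: "\<bar>p t\<bar> < 1" for t using f_reg_optimal(1)[OF lam_pos] by (simp add: p_def)
    have "KL opt.\<kappa> ?R = ereal (opt.U.expectation (\<lambda>w. ln (path_density T a L b M p w)))"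
      using R opt.coupling_density[OF p]
      by (rule KL_density_eq)
        (auto simp: measurable_cong_sets[OF setsR refl] p intro: path_density_pos opt.expectation_ln_path_density)
    also have "\<dots> = ereal (\<Sum>t<T. - ln (1 - (p t)\<^sup>2) / 2)"
      by (simp add: opt.expectation_ln_path_density(2)[OF p] opt.corr_eq power2_eq_square)
    finally show ?thesis
      unfolding opt_cost
      by (simp add: C_def p_def mult.commute sum_negf sum_divide_distrib[symmetric])
  qed
  ultimately show ?thesis
    unfolding AW2_sq_def using INF_lower[OF opt.bicausal, of ?obj]
    by (intro antisym INF_greatest) simp_all
qed

theorem theorem1p1:
  fixes T :: nat and lam :: real
    and a b :: "real Matrix.vec" and A B L M N P :: "real mat"
  assumes "T \<ge> 1" and "lam \<ge> 0"
    and "a \<in> carrier_vec T" and "b \<in> carrier_vec T"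
    and "cholesky T A L" and "cholesky T B M"
    and "N = mat_diag T (\<lambda>t. (transpose_mat M * L) $$ (t, t))"
    and "P = map_mat (f_reg lam) N"
  shows "AW2_sq lam T (gaussian T a A) (gaussian T b B) =
    ereal (scalar_prod (a - b) (a - b) + tr (A + B) - 2 * tr (P * N)
      - lam / 2 * ln (Determinant.det (1\<^sub>m T - P ^\<^sub>m 2)))"
proof -
  have L: "L \<in> carrier_mat T T" "\<And>i. i < T \<Longrightarrow> 0 < L $$ (i, i)"
    "\<And>i j. i < j \<Longrightarrow> j < T \<Longrightarrow> L $$ (i, j) = 0" "A = L * transpose_mat L"
    using assms(5) by (auto simp: cholesky_def)
  have M: "M \<in> carrier_mat T T" "\<And>i. i < T \<Longrightarrow> 0 < M $$ (i, i)"
    "\<And>i j. i < j \<Longrightarrow> j < T \<Longrightarrow> M $$ (i, j) = 0" "B = M * transpose_mat M"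
    using assms(6) by (auto simp: cholesky_def)
  define n where "n t = (\<Sum>i<T. M $$ (i, t) * L $$ (i, t))" for t
  have N: "N = mat_diag T n"
    unfolding assms(7) mat_diag_def using L(1) M(1)
    by (intro eq_matI) (auto simp: n_def scalar_prod_def lessThan_atLeast0)
  \<comment> \<open>\<open>f_reg\<close> vanishes at \<open>0\<close>, so applying it to all entries keeps the matrix diagonal.\<close>
  have P: "P = mat_diag T (\<lambda>t. f_reg lam (n t))"
    unfolding assms(8) N mat_diag_def by (intro eq_matI) (auto simp: f_reg_def)
  have 1: "scalar_prod (a - b) (a - b) = (\<Sum>i<T. (vec_index a i - vec_index b i)\<^sup>2)"
    using assms(3,4) by (simp add: scalar_prod_def lessThan_atLeast0 power2_eq_square)
  have 2: "tr (A + B) = (\<Sum>i<T. \<Sum>j<T. (L $$ (i, j))\<^sup>2) + (\<Sum>i<T. \<Sum>j<T. (M $$ (i, j))\<^sup>2)"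
    unfolding tr_def L(4) M(4) using L(1) M(1)
    by (simp add: scalar_prod_def lessThan_atLeast0 power2_eq_square sum.distrib)
  have 3: "tr (P * N) = (\<Sum>t<T. f_reg lam (n t) * n t)"
    unfolding P N mat_diag_diag by (simp add: tr_def mat_diag_def)
  \<comment> \<open>For \<open>lam = 0\<close> the determinant may vanish; the factor \<open>lam / 2\<close> makes both sides \<open>0\<close>.\<close>
  have 4: "lam / 2 * ln (Determinant.det (1\<^sub>m T - P ^\<^sub>m 2)) = lam / 2 * (\<Sum>t<T. ln (1 - (f_reg lam (n t))\<^sup>2))"
  proof (cases "lam = 0")
    case False
    then have f: "0 < 1 - (f_reg lam (n t))\<^sup>2" for t
      using f_reg_optimal(1)[of lam "n t"] assms(2) by (simp add: abs_square_less_1)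
    have Pc: "P \<in> carrier_mat T T" by (simp add: P)
    then have "P ^\<^sub>m 2 = P * P"
      by (simp add: numeral_2_eq_2 left_mult_one_mat[OF Pc])
    also have "\<dots> = mat_diag T (\<lambda>t. (f_reg lam (n t))\<^sup>2)"
      unfolding P mat_diag_diag by (simp add: power2_eq_square)
    finally have "1\<^sub>m T - P ^\<^sub>m 2 = mat_diag T (\<lambda>t. 1 - (f_reg lam (n t))\<^sup>2)"
      by (intro eq_matI) (auto simp: mat_diag_def)
    also have "Determinant.det \<dots> = (\<Prod>t<T. 1 - (f_reg lam (n t))\<^sup>2)"
      by (subst det_lower_triangular[of T]) (auto simp: mat_diag_def prod_list_diag_prod lessThan_atLeast0)
    finally show ?thesis using f[THEN less_imp_neq] f by (simp only:) (subst ln_prod, auto)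
  qed simp
  show ?thesis
    unfolding gaussian_eq_distr[OF assms(5,3), folded tri_gaussian_def]
      gaussian_eq_distr[OF assms(6,4), folded tri_gaussian_def] 1 2 3 4 n_def add.assoc[symmetric]
    by (rule AW2_sq_tri_gaussian) (use assms(2) L(2,3) M(2,3) in auto)
qed

end
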